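(* Let $\mu:2^{[n]}\to\mathbb{R}_{\geqslant 0}$ be a $d$-homogeneous probability distribution that is strongly log-concave at $\mathbb{1}$. Let $P_\mu$ denote the transition probability matrix of the Markov chain $\mathcal{M}_\mu$, and let $X(k)$ denote the collection of size-$k$ subsets of $[n]$ which are contained in some element of $\operatorname{supp}(\mu)$. Then for every $0\leqslant k\leqslant d-1$, $P_\mu$ has at most $|X(k)|\leqslant\binom{n}{k}$ eigenvalues of value $>1-\frac{k+1}{d}$. In particular, $\mathcal{M}_\mu$ has spectral gap at least $1/d$, and if $\tau\in\operatorname{supp}(\mu)$ and $0<\epsilon<1$, the total variation mixing time of $\mathcal{M}_\mu$ started at $\tau$ satisfies \[ t_\tau(\epsilon)\leqslant d\log\Big(\frac{1}{\epsilon\,\mu(\tau)}\Big).\]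
   Context: For a distribution $\mu$ on subsets of $[n]=\{1,\dots,n\}$, its generating polynomial is $g_\mu(x)=\sum_{S\subseteq[n]}\mu(S)\prod_{i\in S}x_i$; $\mu$ is $d$-homogeneous if $\mu(S)>0$ implies $|S|=d$. A polynomial $p$ with nonnegative coefficients is log-concave at $\mathbb{1}=(1,\dots,1)$ if it is identically zero or the Hessian of $\log p$ at $\mathbb{1}$ is negative semidefinite. It is strongly log-concave at $\mathbb{1}$ if for every $k\geqslant 0$ and every sequence $1\leqslant i_1,\dots,i_k\leqslant n$ (repetitions allowed), $\partial_{i_1}\cdots\partial_{i_k}p$ is log-concave at $\mathbb{1}$; $\mu$ is strongly log-concave at $\mathbb{1}$ if $g_\mu$ is. The chain $\mathcal{M}_\mu$ has state space $\operatorname{supp}(\mu)=\{S:\mu(S)\neq0\}$; from state $\tau$ it removes an element $i\in\tau$ chosen uniformly at random and then moves to a set $\sigma\supseteq\tau\setminus\{i\}$ in $\operatorname{supp}(\mu)$ chosen with probability proportional to $\mu(\sigma)$. The spectral gap is $1$ minus the second largest eigenvalue. For a chain with transition matrix $P$ and stationary distribution $\pi$, $t_\tau(\epsilon)=\min\{t\in\mathbb{Z}_{\geqslant0}:\|P^t(\tau,\cdot)-\pi\|_1\leqslant\epsilon\}$.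
   Formalization: With the unnormalised ℓ1 norm the mixing bound fails for d=1 (n=2, μ({1})=0.42, ε=0.9), so it is proved in ℓ1 for d≥2 and, for all d≥1, in total variation distance (half of ℓ1); d≥1 is assumed, and a one-state chain has gap 1 by convention. *)

theory Defs
  imports
    "HOL-Analysis.Derivative"
    "HOL-Library.Extended_Real"
    "Jordan_Normal_Form.Char_Poly"
begin

section \<open>Distributions on subsets of \<open>{1..n}\<close>\<close>

text \<open>
  A function on the subsets of \<open>{1..n}\<close> is rendered as \<open>\<mu> :: nat set \<Rightarrow> real\<close>; the values of \<open>\<mu>\<close>
  outside \<open>Pow {1..n}\<close> are never used.
\<close>

definition prob_dist :: "nat \<Rightarrow> (nat set \<Rightarrow> real) \<Rightarrow> bool" where
  "prob_dist n \<mu> \<longleftrightarrow> (\<forall>S\<subseteq>{1..n}. 0 \<le> \<mu> S) \<and> (\<Sum>S\<in>Pow {1..n}. \<mu> S) = 1"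

definition homogeneous :: "nat \<Rightarrow> nat \<Rightarrow> (nat set \<Rightarrow> real) \<Rightarrow> bool" where
  "homogeneous n d \<mu> \<longleftrightarrow> (\<forall>S\<subseteq>{1..n}. 0 < \<mu> S \<longrightarrow> card S = d)"

definition supp :: "nat \<Rightarrow> (nat set \<Rightarrow> real) \<Rightarrow> nat set set" where
  "supp n \<mu> = {S. S \<subseteq> {1..n} \<and> \<mu> S \<noteq> 0}"

definition faces :: "nat \<Rightarrow> (nat set \<Rightarrow> real) \<Rightarrow> nat \<Rightarrow> nat set set" where
  "faces n \<mu> k = {T. T \<subseteq> {1..n} \<and> card T = k \<and> (\<exists>S\<in>supp n \<mu>. T \<subseteq> S)}"

section \<open>Strong log-concavity\<close>

text \<open>
  Real polynomials in \<open>x\<^sub>1, \<dots>, x\<^sub>n\<close> are rendered as the functions they induce on points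
  \<open>x :: nat \<Rightarrow> real\<close>, of which only the coordinates in \<open>{1..n}\<close> matter. A real polynomial is zero
  iff the induced function is, and formal and analytic partial derivatives agree.
\<close>

definition gen_poly :: "nat \<Rightarrow> (nat set \<Rightarrow> real) \<Rightarrow> (nat \<Rightarrow> real) \<Rightarrow> real" where
  "gen_poly n \<mu> x = (\<Sum>S\<in>Pow {1..n}. \<mu> S * (\<Prod>i\<in>S. x i))"

definition partial :: "nat \<Rightarrow> ((nat \<Rightarrow> real) \<Rightarrow> real) \<Rightarrow> (nat \<Rightarrow> real) \<Rightarrow> real" where
  "partial i f x = deriv (\<lambda>t. f (x(i := t))) (x i)"

definition hessian :: "((nat \<Rightarrow> real) \<Rightarrow> real) \<Rightarrow> (nat \<Rightarrow> real) \<Rightarrow> nat \<Rightarrow> nat \<Rightarrow> real" where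
  "hessian f x i j = partial i (partial j f) x"

definition neg_semidef :: "nat \<Rightarrow> (nat \<Rightarrow> nat \<Rightarrow> real) \<Rightarrow> bool" where
  "neg_semidef n H \<longleftrightarrow> (\<forall>v :: nat \<Rightarrow> real. (\<Sum>i=1..n. \<Sum>j=1..n. v i * H i j * v j) \<le> 0)"

definition log_concave_at_one :: "nat \<Rightarrow> ((nat \<Rightarrow> real) \<Rightarrow> real) \<Rightarrow> bool" where
  "log_concave_at_one n p \<longleftrightarrow>
     (\<forall>x. p x = 0) \<or> neg_semidef n (hessian (\<lambda>x. ln (p x)) (\<lambda>_. 1))"

definition strongly_log_concave_at_one :: "nat \<Rightarrow> ((nat \<Rightarrow> real) \<Rightarrow> real) \<Rightarrow> bool" where
  "strongly_log_concave_at_one n p \<longleftrightarrow>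
     (\<forall>is. set is \<subseteq> {1..n} \<longrightarrow> log_concave_at_one n (foldr partial is p))"

section \<open>Finite Markov chains\<close>

text \<open>
  A chain is given by a finite state space \<open>\<Omega>\<close> and a kernel \<open>P\<close>, where \<open>P x y\<close> is the probability of
  moving from \<open>x\<close> to \<open>y\<close>. To apply the matrix library, states are numbered by an arbitrary
  enumeration of \<open>\<Omega>\<close>; the characteristic polynomial does not depend on its choice.
\<close>

definition state_list :: "'s set \<Rightarrow> 's list" where
  "state_list \<Omega> = (SOME xs. distinct xs \<and> set xs = \<Omega>)"

lemma state_list:
  assumes "finite \<Omega>"
  shows "distinct (state_list \<Omega>)" "set (state_list \<Omega>) = \<Omega>"
proof -
  have "\<exists>xs. distinct xs \<and> set xs = \<Omega>"
    using finite_distinct_list[OF assms] by blast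
  then have "distinct (state_list \<Omega>) \<and> set (state_list \<Omega>) = \<Omega>"
    unfolding state_list_def by (rule someI_ex)
  then show "distinct (state_list \<Omega>)" "set (state_list \<Omega>) = \<Omega>" by auto
qed

definition transition_mat :: "'s set \<Rightarrow> ('s \<Rightarrow> 's \<Rightarrow> real) \<Rightarrow> real mat" where
  "transition_mat \<Omega> P = Matrix.mat (card \<Omega>) (card \<Omega>)
     (\<lambda>(i, j). P (state_list \<Omega> ! i) (state_list \<Omega> ! j))"

text \<open>The real eigenvalues with algebraic multiplicity; these are all of them for a reversible chain.\<close>

definition eigenvalues :: "'s set \<Rightarrow> ('s \<Rightarrow> 's \<Rightarrow> real) \<Rightarrow> real multiset" where
  "eigenvalues \<Omega> P = proots (char_poly (transition_mat \<Omega> P))"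

text \<open>
  The second largest eigenvalue is counted with multiplicity. A chain with a single state has no
  second eigenvalue; its spectral gap is \<open>1\<close> by convention.
\<close>

definition spectral_gap :: "'s set \<Rightarrow> ('s \<Rightarrow> 's \<Rightarrow> real) \<Rightarrow> real" where
  "spectral_gap \<Omega> P =
     (if card \<Omega> \<le> 1 then 1 else 1 - rev (sorted_list_of_multiset (eigenvalues \<Omega> P)) ! 1)"

primrec kernel_power :: "'s set \<Rightarrow> ('s \<Rightarrow> 's \<Rightarrow> real) \<Rightarrow> nat \<Rightarrow> 's \<Rightarrow> 's \<Rightarrow> real" where
  "kernel_power \<Omega> P 0 x y = (if x = y then 1 else 0)"
| "kernel_power \<Omega> P (Suc t) x y = (\<Sum>z\<in>\<Omega>. P x z * kernel_power \<Omega> P t z y)"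

definition is_stationary :: "'s set \<Rightarrow> ('s \<Rightarrow> 's \<Rightarrow> real) \<Rightarrow> ('s \<Rightarrow> real) \<Rightarrow> bool" where
  "is_stationary \<Omega> P \<pi> \<longleftrightarrow>
     (\<forall>x\<in>\<Omega>. 0 \<le> \<pi> x) \<and> (\<forall>x. x \<notin> \<Omega> \<longrightarrow> \<pi> x = 0) \<and> (\<Sum>x\<in>\<Omega>. \<pi> x) = 1 \<and>
     (\<forall>y\<in>\<Omega>. (\<Sum>x\<in>\<Omega>. \<pi> x * P x y) = \<pi> y)"

definition stationary_dist :: "'s set \<Rightarrow> ('s \<Rightarrow> 's \<Rightarrow> real) \<Rightarrow> 's \<Rightarrow> real" where
  "stationary_dist \<Omega> P = (THE \<pi>. is_stationary \<Omega> P \<pi>)"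

definition l1_dist :: "'s set \<Rightarrow> ('s \<Rightarrow> real) \<Rightarrow> ('s \<Rightarrow> real) \<Rightarrow> real" where
  "l1_dist \<Omega> p q = (\<Sum>x\<in>\<Omega>. \<bar>p x - q x\<bar>)"

definition tv_dist :: "'s set \<Rightarrow> ('s \<Rightarrow> real) \<Rightarrow> ('s \<Rightarrow> real) \<Rightarrow> real" where
  "tv_dist \<Omega> p q = l1_dist \<Omega> p q / 2"

text \<open>
  The mixing time with respect to a distance \<open>D\<close> (\<^const>\<open>l1_dist\<close> or \<^const>\<open>tv_dist\<close>). It is the least
  time at which the distance is at most \<open>\<epsilon>\<close>, and \<open>\<infinity>\<close> if there is none.
\<close>

definition mixing_time ::
  "('s set \<Rightarrow> ('s \<Rightarrow> real) \<Rightarrow> ('s \<Rightarrow> real) \<Rightarrow> real) \<Rightarrow>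
   's set \<Rightarrow> ('s \<Rightarrow> 's \<Rightarrow> real) \<Rightarrow> 's \<Rightarrow> real \<Rightarrow> enat" where
  "mixing_time D \<Omega> P x \<epsilon> =
     Inf (enat ` {t. D \<Omega> (kernel_power \<Omega> P t x) (stationary_dist \<Omega> P) \<le> \<epsilon>})"

section \<open>The chain of a distribution\<close>

definition chain :: "nat \<Rightarrow> (nat set \<Rightarrow> real) \<Rightarrow> nat set \<Rightarrow> nat set \<Rightarrow> real" where
  "chain n \<mu> \<tau> \<sigma> =
     (\<Sum>i\<in>\<tau>. 1 / real (card \<tau>) *
       (if \<sigma> \<in> supp n \<mu> \<and> \<tau> - {i} \<subseteq> \<sigma>
        then \<mu> \<sigma> / (\<Sum>\<rho> | \<rho> \<in> supp n \<mu> \<and> \<tau> - {i} \<subseteq> \<rho>. \<mu> \<rho>)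
        else 0))"

end

theory Submission
  imports Defs "HOL-Analysis.Function_Topology"
begin

text \<open>
  Weight a face \<open>T\<close> by \<open>w T = (d - |T|)! * \<mu>{S. T \<subseteq> S}\<close>, so that \<open>w T\<close> is the sum of the weights of the
  faces covering \<open>T\<close>. Averaging over covering faces (\<open>D\<close>) and summing over covered faces (\<open>U\<close>) are
  then adjoint between consecutive levels, and the chain is \<open>U D / d\<close> on the top level.
  Log-concavity of the derivatives of \<open>g\<^sub>\<mu>\<close> gives, face by face,
  \<open>\<parallel>U h\<parallel>\<^sup>2 \<le> \<parallel>D h\<parallel>\<^sup>2 + \<parallel>h\<parallel>\<^sup>2\<close>. By induction on the level, a function \<open>f\<close> on the top level whose iterated
  average on the \<open>k\<close>-faces vanishes satisfies \<open>\<parallel>D f\<parallel>\<^sup>2 \<le> (d - 1 - k) \<parallel>f\<parallel>\<^sup>2\<close>. These are at most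
  \<open>|X(k)|\<close> linear conditions, so the eigenvalue count follows from an orthonormal eigenbasis of the
  reversible chain. The case \<open>k = 0\<close> contracts mean-zero functions by \<open>1 - 1/d\<close>, and the mixing time
  bound is obtained at time \<open>\<lfloor>d ln (1 / (\<epsilon> \<mu>(\<tau>)))\<rfloor>\<close>.
\<close>

section \<open>Spectral theory of reversible kernels\<close>

text \<open>Gaussian elimination: a pivot unknown is removed from all other equations, leaving one
  equation and one unknown fewer. The result supplies vectors in an orthogonal complement and,
  later, the combination of eigenfunctions in the eigenvalue count.\<close>

lemma homogeneous_system_nontrivial:
  fixes a :: "'j \<Rightarrow> 'i \<Rightarrow> real"
  assumes "finite J" "finite I" "card J < card I"
  shows "\<exists>c. (\<exists>i\<in>I. c i \<noteq> 0) \<and> (\<forall>j\<in>J. (\<Sum>i\<in>I. a j i * c i) = 0)"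
  using assms
proof (induction J arbitrary: I a rule: finite_induct)
  case empty
  then obtain i where "i \<in> I" by (metis card.empty card_gt_0_iff ex_in_conv)
  then show ?case by (intro exI[of _ "\<lambda>_. 1"]) auto
next
  case (insert j J)
  show ?case
  proof (cases "\<forall>i\<in>I. a j i = 0")
    case True
    have "card J < card I" using insert by simp
    from insert.IH[OF insert.prems(1) this, of a] show ?thesis using True by auto
  next
    case False
    then obtain p where p: "p \<in> I" "a j p \<noteq> 0" by auto
    have less: "card J < card (I - {p})" using insert p by simp
    \<comment> \<open>The coefficients left in the other equations once equation \<open>j\<close>
      has been solved for the unknown \<open>p\<close>.\<close>
    define b where "b l i = a l i - a l p * a j i / a j p" for l i
    obtain c where c: "\<exists>i\<in>I - {p}. c i \<noteq> 0" "\<forall>l\<in>J. (\<Sum>i\<in>I - {p}. b l i * c i) = 0"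
      using insert.IH[OF _ less, of b] insert.prems by auto
    define s where "s = (\<Sum>i\<in>I - {p}. a j i * c i)"
    define c' where "c' = c(p := - s / a j p)"
    have split: "(\<Sum>i\<in>I. a l i * c' i) = a l p * (- s / a j p) + (\<Sum>i\<in>I - {p}. a l i * c i)" for l
      using p insert.prems(1) by (simp add: sum.remove[of I p] c'_def)
    have "(\<Sum>i\<in>I. a j i * c' i) = 0"
      using p by (simp add: split s_def)
    moreover have "(\<Sum>i\<in>I. a l i * c' i) = 0" if "l \<in> J" for l
    proof -
      have "(\<Sum>i\<in>I - {p}. b l i * c i)
          = (\<Sum>i\<in>I - {p}. a l i * c i - (a l p / a j p) * (a j i * c i))"
        by (rule sum.cong) (simp_all add: b_def algebra_simps)
      also have "\<dots> = (\<Sum>i\<in>I. a l i * c' i)"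
        by (simp add: split s_def sum_subtractf flip: sum_distrib_left sum_divide_distrib)
      finally show ?thesis using c(2) that by simp
    qed
    moreover have "\<exists>i\<in>I. c' i \<noteq> 0" using c(1) by (auto simp: c'_def)
    ultimately show ?thesis by blast
  qed
qed

text \<open>For small positive \<open>t\<close> the linear term dominates, so a positive
  \<open>s\<close> would make the expression negative. This is the first-order condition at a
  maximum of the Rayleigh quotient.\<close>

lemma quadratic_nonneg_imp_linear_coeff_zero:
  fixes s e :: real
  assumes "\<And>t. 0 \<le> t\<^sup>2 * e - 2 * t * s" and "0 \<le> s"
  shows "s = 0"
proof (rule ccontr)
  assume "s \<noteq> 0"
  with assms have s: "s > 0" by simp
  have e: "0 \<le> e" using assms(1)[of 1] s by simp
  \<comment> \<open>Chosen so that \<open>t * e < s\<close>; the summand 1 in the denominator covers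
    \<open>e = 0\<close>.\<close>
  define t where "t = s / (e + 1)"
  have t: "t > 0" using s e by (simp add: t_def)
  have "t * e < 2 * s"
    using s e by (simp add: t_def field_simps) (smt (verit, best) mult_nonneg_nonneg)
  then have "t * (t * e - 2 * s) < 0" using t by (simp add: mult_pos_neg)
  with assms(1)[of t] show False by (simp add: power2_eq_square algebra_simps)
qed

text \<open>By Tychonoff's theorem the box with sides \<open>{- M x..M x}\<close> is compact in the
  product topology. Hence functions on the whole type \<open>'s\<close>, which may be infinite, can
  be used in place of vectors.\<close>

lemma compact_bounded_coordinates:
  fixes S :: "('s \<Rightarrow> real) set"
  assumes "closed S" and "\<And>f x. f \<in> S \<Longrightarrow> \<bar>f x\<bar> \<le> M x"
  shows "compact S"
proof -
  have "compactin (product_topology (\<lambda>_. euclidean) UNIV) (PiE UNIV (\<lambda>x. {- M x..M x}))"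
    by (subst compactin_PiE) auto
  then have "compact (PiE UNIV (\<lambda>x. {- M x..M x}))"
    by (simp add: euclidean_product_topology)
  moreover have "S \<subseteq> PiE UNIV (\<lambda>x. {- M x..M x})"
    using assms(2) by (auto simp: abs_le_iff) (metis minus_le_iff)
  ultimately show ?thesis
    using assms(1) by (metis compact_Int_closed inf.absorb_iff2)
qed

section \<open>The weighted inner product and an orthonormal eigenbasis\<close>

locale reversible_kernel =
  fixes \<Omega> :: "'s set" and w :: "'s \<Rightarrow> real" and K :: "'s \<Rightarrow> 's \<Rightarrow> real"
  assumes fin: "finite \<Omega>"
    and weight_pos: "\<And>x. x \<in> \<Omega> \<Longrightarrow> 0 < w x"
    and reversible: "\<And>x y. x \<in> \<Omega> \<Longrightarrow> y \<in> \<Omega> \<Longrightarrow> w x * K x y = w y * K y x"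
begin

definition ip :: "('s \<Rightarrow> real) \<Rightarrow> ('s \<Rightarrow> real) \<Rightarrow> real" where
  "ip f g = (\<Sum>x\<in>\<Omega>. w x * f x * g x)"

definition app :: "('s \<Rightarrow> real) \<Rightarrow> 's \<Rightarrow> real" where
  "app f x = (\<Sum>y\<in>\<Omega>. K x y * f y)"

lemma ip_commute: "ip f g = ip g f"
  by (simp add: ip_def mult_ac)

lemma ip_add_left: "ip (\<lambda>x. f x + g x) h = ip f h + ip g h"
  by (simp add: ip_def algebra_simps sum.distrib)

lemma ip_diff_left: "ip (\<lambda>x. f x - g x) h = ip f h - ip g h"
  by (simp add: ip_def algebra_simps sum_subtractf)

lemma ip_scale_left: "ip (\<lambda>x. c * f x) h = c * ip f h"
  by (simp add: ip_def algebra_simps sum_distrib_left)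

lemma ip_sum_left: "ip (\<lambda>x. \<Sum>i\<in>I. f i x) h = (\<Sum>i\<in>I. ip (f i) h)"
  by (simp add: ip_def sum_distrib_left sum_distrib_right) (rule sum.swap)

lemma ip_add_right: "ip h (\<lambda>x. f x + g x) = ip h f + ip h g"
  by (simp add: ip_commute[of h] ip_add_left)

lemma ip_scale_right: "ip h (\<lambda>x. c * f x) = c * ip h f"
  by (simp add: ip_commute[of h] ip_scale_left)

lemma ip_sum_right: "ip h (\<lambda>x. \<Sum>i\<in>I. f i x) = (\<Sum>i\<in>I. ip h (f i))"
  by (simp add: ip_commute[of h] ip_sum_left)

lemma ip_cong: "(\<And>x. x \<in> \<Omega> \<Longrightarrow> f x = f' x) \<Longrightarrow> (\<And>x. x \<in> \<Omega> \<Longrightarrow> g x = g' x) \<Longrightarrow> ip f g = ip f' g'"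
  by (simp add: ip_def)

lemma ip_nonneg: "0 \<le> ip f f"
  unfolding ip_def by (intro sum_nonneg) (simp add: weight_pos less_imp_le mult.assoc)

lemma ip_eq_0D: "ip f f = 0 \<Longrightarrow> x \<in> \<Omega> \<Longrightarrow> f x = 0"
proof -
  assume "ip f f = 0" and x: "x \<in> \<Omega>"
  then have "\<forall>x\<in>\<Omega>. w x * f x * f x = 0"
    unfolding ip_def using fin
    by (subst (asm) sum_nonneg_eq_0_iff) (auto simp: weight_pos less_imp_le mult.assoc)
  with x weight_pos[OF x] show "f x = 0" by auto
qed

lemma app_add: "app (\<lambda>x. f x + g x) = (\<lambda>x. app f x + app g x)"
  by (simp add: app_def fun_eq_iff algebra_simps sum.distrib)

lemma app_scale: "app (\<lambda>x. c * f x) = (\<lambda>x. c * app f x)"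
  by (simp add: app_def fun_eq_iff algebra_simps sum_distrib_left)

lemma app_cong: "(\<And>x. x \<in> \<Omega> \<Longrightarrow> f x = f' x) \<Longrightarrow> app f = app f'"
  by (auto simp: app_def fun_eq_iff)

lemma ip_app_left: "ip (app f) g = ip f (app g)"
proof -
  have "ip (app f) g = (\<Sum>x\<in>\<Omega>. \<Sum>y\<in>\<Omega>. (w x * K x y) * f y * g x)"
    by (simp add: ip_def app_def sum_distrib_left sum_distrib_right mult_ac)
  also have "\<dots> = (\<Sum>x\<in>\<Omega>. \<Sum>y\<in>\<Omega>. (w y * K y x) * f y * g x)"
    by (intro sum.cong refl) (simp add: reversible)
  also have "\<dots> = (\<Sum>y\<in>\<Omega>. \<Sum>x\<in>\<Omega>. (w y * K y x) * f y * g x)"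
    by (rule sum.swap)
  also have "\<dots> = ip f (app g)"
    by (simp add: ip_def app_def sum_distrib_left mult_ac)
  finally show ?thesis .
qed

definition orthonormal_eigenfamily :: "nat \<Rightarrow> (nat \<Rightarrow> 's \<Rightarrow> real) \<Rightarrow> (nat \<Rightarrow> real) \<Rightarrow> bool" where
  "orthonormal_eigenfamily m \<phi> l \<longleftrightarrow>
     (\<forall>i<m. \<forall>j<m. ip (\<phi> i) (\<phi> j) = (if i = j then 1 else 0)) \<and>
     (\<forall>i<m. \<forall>x\<in>\<Omega>. app (\<phi> i) x = l i * \<phi> i x)"

text \<open>
  A maximiser \<open>f\<close> of the Rayleigh quotient on the orthogonal complement is an eigenfunction:
  perturbing it in the direction \<open>h = app f - e f\<close> forces \<open>h = 0\<close>.
\<close>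

lemma eigenfunction_orthogonal_to:
  assumes fam: "orthonormal_eigenfamily m \<phi> l" and "m < card \<Omega>"
  shows "\<exists>f e. ip f f = 1 \<and> (\<forall>i<m. ip f (\<phi> i) = 0) \<and> (\<forall>x\<in>\<Omega>. app f x = e * f x)"
proof -
  \<comment> \<open>The inner product ignores values off \<open>\<Omega>\<close>; fixing them to
    zero makes every coordinate bounded on \<open>S\<close>, as compactness requires.\<close>
  define S where "S = {f. ip f f = 1 \<and> (\<forall>i<m. ip f (\<phi> i) = 0) \<and> (\<forall>x. x \<notin> \<Omega> \<longrightarrow> f x = 0)}"
  have cont: "continuous_on UNIV (\<lambda>f. ip (A f) (B f))"
    if "\<And>x. continuous_on UNIV (\<lambda>f. A f x)" "\<And>x. continuous_on UNIV (\<lambda>f. B f x)"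
    for A B :: "('s \<Rightarrow> real) \<Rightarrow> 's \<Rightarrow> real"
    unfolding ip_def by (intro continuous_intros that)
  have normalise: "\<exists>g\<in>S. \<exists>c. c\<^sup>2 = ip f f \<and> (\<forall>x\<in>\<Omega>. f x = c * g x)"
    if orth: "\<forall>i<m. ip f (\<phi> i) = 0" and nz: "ip f f \<noteq> 0" for f
  proof -
    have pos: "ip f f > 0" using nz ip_nonneg[of f] by simp
    define c where "c = sqrt (ip f f)"
    have c: "c > 0" "c\<^sup>2 = ip f f" using pos by (simp_all add: c_def)
    define g where "g x = (if x \<in> \<Omega> then (1 / c) * f x else 0)" for x
    have g: "ip g h = (1 / c) * ip f h" for h
      unfolding ip_scale_left[symmetric] by (rule ip_cong) (auto simp: g_def)
    have "ip g g = 1" unfolding g ip_commute[of f g] using c pos by (simp add: power2_eq_square[symmetric])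
    then have "g \<in> S" using orth by (simp add: S_def g) (simp add: g_def)
    moreover have "\<forall>x\<in>\<Omega>. f x = c * g x" using c by (simp add: g_def)
    ultimately show ?thesis using c by blast
  qed
  have "closed S"
  proof -
    have "S = {f. ip f f = 1} \<inter> (\<Inter>i\<in>{..<m}. {f. ip f (\<phi> i) = 0}) \<inter> (\<Inter>x\<in>- \<Omega>. {f. f x = 0})"
      by (auto simp: S_def)
    also have "closed \<dots>"
      by (intro closed_Int closed_INT ballI closed_Collect_eq cont continuous_intros) auto
    finally show ?thesis .
  qed
  moreover have "\<bar>f x\<bar> \<le> (if x \<in> \<Omega> then sqrt (1 / w x) else 0)" if "f \<in> S" for f x
  proof (cases "x \<in> \<Omega>")
    case True
    have "w x * f x * f x \<le> ip f f"
      unfolding ip_def using fin True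
      by (intro member_le_sum) (auto simp: weight_pos less_imp_le mult.assoc)
    then have "(f x)\<^sup>2 \<le> 1 / w x"
      using that weight_pos[OF True] by (simp add: S_def field_simps power2_eq_square)
    then show ?thesis using True by (simp add: real_le_rsqrt)
  qed (use that in \<open>auto simp: S_def\<close>)
  ultimately have comp: "compact S" by (rule compact_bounded_coordinates)
  have "S \<noteq> {}"
  proof -
    obtain c where c: "\<exists>x\<in>\<Omega>. c x \<noteq> 0" "\<forall>i\<in>{..<m}. (\<Sum>x\<in>\<Omega>. (w x * \<phi> i x) * c x) = 0"
      using homogeneous_system_nontrivial[of "{..<m}" \<Omega> "\<lambda>i x. w x * \<phi> i x"] fin assms(2) by auto
    have "\<forall>i<m. ip c (\<phi> i) = 0" using c(2) by (simp add: ip_def mult_ac)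
    moreover have "ip c c \<noteq> 0" using c(1) ip_eq_0D by blast
    ultimately show ?thesis using normalise by blast
  qed
  moreover have "continuous_on S (\<lambda>f. ip f (app f))"
    by (rule continuous_on_subset[OF cont]) (auto simp: app_def intro!: continuous_intros)
  ultimately obtain f where f: "f \<in> S" and max: "\<And>g. g \<in> S \<Longrightarrow> ip g (app g) \<le> ip f (app f)"
    using continuous_attains_sup[OF comp] by metis
  define e where "e = ip f (app f)"
  define h where "h = (\<lambda>x. app f x - e * f x)"
  \<comment> \<open>The orthogonal complement is invariant because \<open>app\<close> is
    self-adjoint and each \<open>\<phi> i\<close> is an eigenfunction. So \<open>h\<close> is an
    admissible direction of perturbation.\<close>
  have orth_app: "ip (app g) (\<phi> i) = 0" if "i < m" "ip g (\<phi> i) = 0" for g i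
  proof -
    have "ip (app g) (\<phi> i) = ip g (\<lambda>x. l i * \<phi> i x)"
      unfolding ip_app_left using fam that(1)
      by (intro ip_cong) (auto simp: orthonormal_eigenfamily_def)
    then show ?thesis using that(2) by (simp add: ip_scale_right)
  qed
  have f1: "ip f f = 1" and fo: "\<forall>i<m. ip f (\<phi> i) = 0" using f by (auto simp: S_def)
  have ho: "\<forall>i<m. ip h (\<phi> i) = 0"
    using fo orth_app by (simp add: h_def ip_diff_left ip_scale_left)
  have bound: "ip g (app g) \<le> e * ip g g" if go: "\<forall>i<m. ip g (\<phi> i) = 0" for g
  proof (cases "ip g g = 0")
    case True
    then have "ip g (app g) = ip (\<lambda>_. 0) (app g)" by (intro ip_cong) (auto dest: ip_eq_0D)
    then show ?thesis using True by (simp add: ip_def)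
  next
    case False
    then obtain g' c where g': "g' \<in> S" "c\<^sup>2 = ip g g" "\<forall>x\<in>\<Omega>. g x = c * g' x"
      using normalise[OF go] by blast
    have "app g = (\<lambda>x. c * app g' x)" unfolding app_scale[symmetric] using g'(3) by (intro app_cong) auto
    then have "ip g (app g) = ip (\<lambda>x. c * g' x) (\<lambda>x. c * app g' x)"
      using g'(3) by (intro ip_cong) auto
    also have "\<dots> = c\<^sup>2 * ip g' (app g')"
      by (simp add: ip_scale_left ip_scale_right power2_eq_square)
    also have "\<dots> \<le> c\<^sup>2 * e" using max[OF g'(1)] by (simp add: e_def mult_left_mono)
    finally show ?thesis by (simp add: g'(2) mult.commute)
  qed
  have fh: "ip f (app h) - e * ip f h = ip h h"
    by (simp add: h_def ip_diff_left ip_scale_left flip: ip_app_left)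
  \<comment> \<open>In \<open>bound\<close> at \<open>f + t * h\<close> the constant terms cancel,
    and \<open>fh\<close> identifies the linear coefficient as a multiple of
    \<open>ip h h\<close>.\<close>
  have "0 \<le> t\<^sup>2 * (e * ip h h - ip h (app h)) - 2 * t * ip h h" for t
  proof -
    have "ip (\<lambda>x. f x + t * h x) (app (\<lambda>x. f x + t * h x)) \<le> e * ip (\<lambda>x. f x + t * h x) (\<lambda>x. f x + t * h x)"
      using fo ho by (intro bound) (simp add: ip_add_left ip_scale_left)
    moreover have "ip h (app f) = ip f (app h)" by (metis ip_app_left ip_commute)
    ultimately show ?thesis
      using fh f1 e_def ip_commute[of h f]
      by (simp add: ip_add_left ip_scale_left ip_add_right ip_scale_right app_add app_scale
          power2_eq_square algebra_simps)
  qed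
  then have "ip h h = 0" using ip_nonneg by (rule quadratic_nonneg_imp_linear_coeff_zero)
  then have "\<forall>x\<in>\<Omega>. app f x = e * f x" using ip_eq_0D[of h] by (auto simp: h_def)
  then show ?thesis using f1 fo by blast
qed

lemma orthonormal_eigenbasis_exists: "\<exists>\<phi> l. orthonormal_eigenfamily (card \<Omega>) \<phi> l"
proof -
  have "\<exists>\<phi> l. orthonormal_eigenfamily m \<phi> l" if "m \<le> card \<Omega>" for m
    using that
  proof (induction m)
    case 0
    then show ?case by (simp add: orthonormal_eigenfamily_def)
  next
    case (Suc m)
    then obtain \<phi> l where fam: "orthonormal_eigenfamily m \<phi> l" by auto
    obtain f e where "ip f f = 1" "\<forall>i<m. ip f (\<phi> i) = 0" "\<forall>x\<in>\<Omega>. app f x = e * f x"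
      using eigenfunction_orthogonal_to[OF fam] Suc.prems by auto
    then have "orthonormal_eigenfamily (Suc m) (\<phi>(m := f)) (l(m := e))"
      using fam ip_commute by (auto simp: orthonormal_eigenfamily_def less_Suc_eq)
    then show ?case by blast
  qed
  then show ?thesis by blast
qed

text \<open>The columns of \<open>F\<close> are the eigenfunctions, and orthonormality says that
  \<open>G\<close>, the transpose of \<open>F\<close> scaled by the weights, inverts it. So the
  transition matrix is similar to the diagonal \<open>L\<close>, and its characteristic polynomial
  splits over the reals.\<close>

lemma eigenvalues_eq_eigenbasis:
  assumes fam: "orthonormal_eigenfamily (card \<Omega>) \<phi> l"
  shows "eigenvalues \<Omega> K = mset (map l [0..<card \<Omega>])"
proof -
  define N where "N = card \<Omega>"
  define s where "s = state_list \<Omega>"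
  have s: "distinct s" "set s = \<Omega>" "length s = N"
    using state_list[OF fin] by (auto simp: s_def N_def simp flip: distinct_card)
  have sum_s: "(\<Sum>i = 0..<N. g (s ! i)) = sum g \<Omega>" for g :: "'s \<Rightarrow> real"
  proof -
    have "bij_betw (\<lambda>i. s ! i) {0..<N} \<Omega>"
      using bij_betw_nth[OF s(1), of "{0..<N}" \<Omega>] s by (auto simp: lessThan_atLeast0)
    then show ?thesis by (rule sum.reindex_bij_betw)
  qed
  have s_in: "s ! i \<in> \<Omega>" if "i < N" for i using s that by (metis nth_mem)
  define T where "T = transition_mat \<Omega> K"
  define F where "F = Matrix.mat N N (\<lambda>(i, j). \<phi> j (s ! i))"
  define G where "G = Matrix.mat N N (\<lambda>(i, j). \<phi> i (s ! j) * w (s ! j))"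
  define L where "L = Matrix.mat N N (\<lambda>(i, j). if i = j then l i else 0)"
  have carr: "T \<in> carrier_mat N N" "F \<in> carrier_mat N N" "G \<in> carrier_mat N N" "L \<in> carrier_mat N N"
    by (auto simp: T_def transition_mat_def F_def G_def L_def N_def)
  have GF: "G * F = 1\<^sub>m N"
  proof (rule eq_matI)
    fix i j assume ij: "i < dim_row (1\<^sub>m N :: real mat)" "j < dim_col (1\<^sub>m N :: real mat)"
    then have "(G * F) $$ (i, j) = (\<Sum>a = 0..<N. \<phi> i (s ! a) * w (s ! a) * \<phi> j (s ! a))"
      by (simp add: G_def F_def scalar_prod_def)
    also have "\<dots> = ip (\<phi> i) (\<phi> j)"
      by (subst sum_s[of "\<lambda>x. \<phi> i x * w x * \<phi> j x"]) (simp add: ip_def mult_ac)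
    finally show "(G * F) $$ (i, j) = 1\<^sub>m N $$ (i, j)"
      using fam ij by (simp add: orthonormal_eigenfamily_def N_def)
  qed (use carr in auto)
  then have FG: "F * G = 1\<^sub>m N" using mat_mult_left_right_inverse carr by blast
  have TF: "T * F = F * L"
  proof (rule eq_matI)
    fix i j assume "i < dim_row (F * L)" "j < dim_col (F * L)"
    then have ij: "i < N" "j < N" using carr by auto
    then have "(T * F) $$ (i, j) = (\<Sum>a = 0..<N. K (s ! i) (s ! a) * \<phi> j (s ! a))"
      by (simp add: T_def transition_mat_def F_def scalar_prod_def N_def s_def)
    also have "\<dots> = app (\<phi> j) (s ! i)"
      by (subst sum_s[of "\<lambda>x. K (s ! i) x * \<phi> j x"]) (simp add: app_def)
    also have "\<dots> = l j * \<phi> j (s ! i)"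
      using fam ij s_in by (simp add: orthonormal_eigenfamily_def N_def)
    also have "\<dots> = (F * L) $$ (i, j)"
      using ij by (simp add: F_def L_def scalar_prod_def if_distrib sum.delta cong: if_cong)
    finally show "(T * F) $$ (i, j) = (F * L) $$ (i, j)" .
  qed (use carr in auto)
  have "T = T * (F * G)" using carr FG by simp
  also have "\<dots> = F * L * G" unfolding TF[symmetric] by (rule assoc_mult_mat[symmetric]) (fact carr)+
  finally have "similar_mat T L"
    using carr FG GF by (intro similar_matI[of _ _ F G N]) auto
  then have "char_poly T = char_poly L" by (rule char_poly_similar)
  also have "\<dots> = (\<Prod>a\<leftarrow>diag_mat L. [:- a, 1:])"
    by (rule char_poly_upper_triangular[OF carr(4)]) (auto simp: upper_triangular_def L_def)
  also have "diag_mat L = map l [0..<N]" by (simp add: diag_mat_def L_def)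
  finally have cp: "char_poly T = (\<Prod>a\<leftarrow>map l [0..<N]. [:- a, 1:])" .
  have "proots (\<Prod>a\<leftarrow>xs. [:- a, 1:]) = mset xs" for xs :: "real list"
  proof (induction xs)
    case (Cons a xs)
    have "(\<Prod>a\<leftarrow>xs. [:- a, 1:]) \<noteq> 0" by (auto simp: prod_list_zero_iff)
    then show ?case using Cons
      by (simp only: list.map prod_list.Cons) (subst proots_mult, auto)
  qed simp
  then show ?thesis unfolding eigenvalues_def T_def[symmetric] cp N_def .
qed

lemma size_eigenvalues: "size (eigenvalues \<Omega> K) = card \<Omega>"
  using orthonormal_eigenbasis_exists eigenvalues_eq_eigenbasis by fastforce

text \<open>A dimension count: with more eigenvalues above \<open>a\<close> than functionals, some
  nonzero combination of their eigenfunctions is annihilated by every functional, yet its Rayleigh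
  quotient exceeds \<open>a\<close>.\<close>

lemma eigenvalues_above_count:
  fixes A :: "'j \<Rightarrow> ('s \<Rightarrow> real) \<Rightarrow> real"
  assumes "finite J"
    and lin: "\<And>j (I :: nat set) c f. j \<in> J \<Longrightarrow> A j (\<lambda>x. \<Sum>i\<in>I. c i * f i x) = (\<Sum>i\<in>I. c i * A j (f i))"
    and bound: "\<And>f. (\<And>j. j \<in> J \<Longrightarrow> A j f = 0) \<Longrightarrow> ip f (app f) \<le> a * ip f f"
  shows "size {#e \<in># eigenvalues \<Omega> K. e > a#} \<le> card J"
proof (rule ccontr)
  obtain \<phi> l where fam: "orthonormal_eigenfamily (card \<Omega>) \<phi> l"
    using orthonormal_eigenbasis_exists by blast
  define I where "I = {i. i < card \<Omega> \<and> l i > a}"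
  have I: "finite I" by (simp add: I_def)
  have "size {#e \<in># eigenvalues \<Omega> K. e > a#} = length (filter (\<lambda>i. l i > a) [0..<card \<Omega>])"
    unfolding eigenvalues_eq_eigenbasis[OF fam] mset_filter[symmetric]
    by (simp only: filter_map size_mset length_map o_def)
  also have "\<dots> = card I"
  proof -
    have "I = set (filter (\<lambda>i. l i > a) [0..<card \<Omega>])" by (auto simp: I_def)
    then show ?thesis by (metis distinct_card distinct_filter distinct_upt)
  qed
  finally have size: "size {#e \<in># eigenvalues \<Omega> K. e > a#} = card I" .
  assume "\<not> ?thesis"
  then obtain c where c: "\<exists>i\<in>I. c i \<noteq> 0" "\<forall>j\<in>J. (\<Sum>i\<in>I. A j (\<phi> i) * c i) = 0"
    using homogeneous_system_nontrivial[of J I "\<lambda>j i. A j (\<phi> i)"] assms(1) I size by auto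
  define f where "f x = (\<Sum>i\<in>I. c i * \<phi> i x)" for x
  have on: "ip (\<phi> i) (\<phi> j) = (if i = j then 1 else 0)" if "i \<in> I" "j \<in> I" for i j
    using fam that by (auto simp: orthonormal_eigenfamily_def I_def)
  have expand: "ip f (\<lambda>x. \<Sum>j\<in>I. b j * \<phi> j x) = (\<Sum>i\<in>I. c i * b i)" for b
  proof -
    have "ip f (\<lambda>x. \<Sum>j\<in>I. b j * \<phi> j x) = (\<Sum>i\<in>I. \<Sum>j\<in>I. c i * b j * ip (\<phi> i) (\<phi> j))"
      unfolding f_def
      by (simp add: ip_sum_left ip_sum_right ip_scale_left ip_scale_right sum_distrib_left mult_ac)
    also have "\<dots> = (\<Sum>i\<in>I. \<Sum>j\<in>I. if i = j then c i * b j else 0)"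
      by (intro sum.cong refl) (simp add: on)
    finally show ?thesis using I by simp
  qed
  have "ip f (app f) = ip f (\<lambda>x. \<Sum>i\<in>I. c i * l i * \<phi> i x)"
  proof (rule ip_cong)
    fix x assume x: "x \<in> \<Omega>"
    have "app f x = (\<Sum>y\<in>\<Omega>. \<Sum>i\<in>I. c i * (K x y * \<phi> i y))"
      by (simp add: app_def f_def sum_distrib_left mult_ac)
    also have "\<dots> = (\<Sum>i\<in>I. c i * app (\<phi> i) x)"
      by (subst sum.swap) (simp add: app_def sum_distrib_left)
    also have "\<dots> = (\<Sum>i\<in>I. c i * l i * \<phi> i x)"
      using fam x by (intro sum.cong refl) (auto simp: orthonormal_eigenfamily_def I_def)
    finally show "app f x = (\<Sum>i\<in>I. c i * l i * \<phi> i x)" .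
  qed simp
  also have "\<dots> = (\<Sum>i\<in>I. c i * (c i * l i))" by (rule expand)
  finally have q: "ip f (app f) = (\<Sum>i\<in>I. l i * (c i)\<^sup>2)" by (simp add: power2_eq_square mult_ac)
  have "ip f f = (\<Sum>i\<in>I. c i * c i)" using expand[of c] by (simp flip: f_def)
  then have "a * ip f f = (\<Sum>i\<in>I. a * (c i)\<^sup>2)" by (simp add: power2_eq_square sum_distrib_left)
  also have "\<dots> < (\<Sum>i\<in>I. l i * (c i)\<^sup>2)"
    using c(1) by (intro sum_strict_mono_ex1 I) (auto simp: I_def intro!: mult_right_mono)
  finally have "a * ip f f < ip f (app f)" by (simp add: q)
  moreover have "A j f = 0" if "j \<in> J" for j
    using c(2) that lin[OF that, where I = I and c = c and f = \<phi>] by (simp add: f_def[abs_def] mult.commute)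
  ultimately show False using bound[of f] by force
qed

end

section \<open>Convergence of contracting kernels\<close>

lemma weighted_Cauchy_Schwarz:
  fixes w f g :: "'a \<Rightarrow> real"
  assumes "\<And>x. x \<in> A \<Longrightarrow> 0 \<le> w x"
  shows "(\<Sum>x\<in>A. w x * f x * g x)\<^sup>2 \<le> (\<Sum>x\<in>A. w x * f x * f x) * (\<Sum>x\<in>A. w x * g x * g x)"
proof -
  have eq: "(\<Sum>x\<in>A. (sqrt (w x) * f x) * (sqrt (w x) * g x)) = (\<Sum>x\<in>A. w x * f x * g x)" for f g
    using assms by (intro sum.cong refl) (simp add: algebra_simps flip: real_sqrt_mult)
  show ?thesis
    using Cauchy_Schwarz_ineq_sum[of "\<lambda>x. sqrt (w x) * f x" "\<lambda>x. sqrt (w x) * g x" A]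
    by (simp only: eq power2_eq_square[of "_ * _"])
qed

text \<open>In the descending list, index 1 is the second largest entry with multiplicity. If it
  exceeded \<open>a\<close>, so would the entry before it.\<close>

lemma second_largest_le:
  fixes M :: "real multiset"
  assumes "size {#e \<in># M. e > a#} \<le> 1" "2 \<le> size M"
  shows "rev (sorted_list_of_multiset M) ! 1 \<le> a"
proof (rule ccontr)
  define xs where "xs = rev (sorted_list_of_multiset M)"
  have M: "mset xs = M" by (simp add: xs_def)
  then have "2 \<le> length xs" using assms(2) by (metis size_mset)
  then obtain x y zs where xs: "xs = x # y # zs"
    by (metis One_nat_def Suc_1 Suc_le_length_iff)
  have "sorted (rev xs)" by (simp add: xs_def)
  then have "y \<le> x" by (simp add: xs sorted_append)
  moreover assume "\<not> ?thesis"
  then have "y > a" by (simp add: xs flip: xs_def)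
  ultimately have "size {#e \<in># M. e > a#} \<ge> 2" by (simp add: xs flip: M)
  then show False using assms(1) by simp
qed

context reversible_kernel
begin

text \<open>\<open>kernel_power\<close> splits off the first step; detailed balance for powers
  reverses paths and so also needs the last step split off.\<close>

lemma kernel_power_Suc_right:
  assumes "x \<in> \<Omega>" "y \<in> \<Omega>"
  shows "kernel_power \<Omega> K (Suc t) x y = (\<Sum>z\<in>\<Omega>. kernel_power \<Omega> K t x z * K z y)"
  using assms
proof (induction t arbitrary: x)
  case 0
  then show ?case using fin by (simp add: if_distrib[of "\<lambda>a. _ * a"] if_distrib[of "\<lambda>a. a * _"] cong: if_cong)
next
  case (Suc t)
  have "kernel_power \<Omega> K (Suc (Suc t)) x y
      = (\<Sum>z\<in>\<Omega>. K x z * (\<Sum>z'\<in>\<Omega>. kernel_power \<Omega> K t z z' * K z' y))"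
    unfolding kernel_power.simps(2)[of _ _ "Suc t"] using Suc by (intro sum.cong refl) simp
  also have "\<dots> = (\<Sum>z\<in>\<Omega>. \<Sum>z'\<in>\<Omega>. K x z * kernel_power \<Omega> K t z z' * K z' y)"
    by (simp add: sum_distrib_left mult.assoc)
  also have "\<dots> = (\<Sum>z'\<in>\<Omega>. \<Sum>z\<in>\<Omega>. K x z * kernel_power \<Omega> K t z z' * K z' y)" by (rule sum.swap)
  also have "\<dots> = (\<Sum>z'\<in>\<Omega>. kernel_power \<Omega> K (Suc t) x z' * K z' y)"
    by (simp add: sum_distrib_right)
  finally show ?case .
qed

text \<open>Detailed balance is applied along the path, one step at a time. It turns the row of a
  starting state into a column, and columns evolve under \<open>app\<close>.\<close>

lemma kernel_power_reversible:
  assumes "x \<in> \<Omega>" "y \<in> \<Omega>"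
  shows "w x * kernel_power \<Omega> K t x y = w y * kernel_power \<Omega> K t y x"
  using assms
proof (induction t arbitrary: x y)
  case (Suc t)
  have "w x * kernel_power \<Omega> K (Suc t) x y = (\<Sum>z\<in>\<Omega>. (w x * K x z) * kernel_power \<Omega> K t z y)"
    by (simp add: sum_distrib_left mult.assoc)
  also have "\<dots> = (\<Sum>z\<in>\<Omega>. K z x * (w z * kernel_power \<Omega> K t z y))"
    using Suc.prems by (intro sum.cong refl) (simp add: reversible mult_ac)
  also have "\<dots> = (\<Sum>z\<in>\<Omega>. K z x * (w y * kernel_power \<Omega> K t y z))"
    using Suc by (intro sum.cong refl) simp
  also have "\<dots> = w y * kernel_power \<Omega> K (Suc t) y x"
    unfolding kernel_power_Suc_right[OF Suc.prems(2,1)] by (simp add: sum_distrib_left mult_ac)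
  finally show ?case .
qed auto

end

text \<open>The contraction is a norm bound rather than an upper bound on the quadratic form:
  convergence also requires control of negative eigenvalues.\<close>

locale contracting_kernel = reversible_kernel +
  fixes c :: real
  assumes weight_sum: "sum w \<Omega> = 1"
    and app_one: "\<And>x. x \<in> \<Omega> \<Longrightarrow> app (\<lambda>_. 1) x = 1"
    and contraction: "\<And>f. ip f (\<lambda>_. 1) = 0 \<Longrightarrow> ip (app f) (app f) \<le> c\<^sup>2 * ip f f"
    and c_nonneg: "0 \<le> c" and c_less: "c < 1"
begin

lemma ip_app_one: "ip (app f) (\<lambda>_. 1) = ip f (\<lambda>_. 1)"
  unfolding ip_app_left by (rule ip_cong) (auto simp: app_one)

text \<open>For uniqueness, the relative error \<open>p x / w x - 1\<close> of a stationary
  \<open>p\<close> has mean zero and, by reversibility, is fixed by \<open>app\<close>. A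
  contraction with factor below 1 fixes only zero.\<close>

lemma stationary_dist_eq: "stationary_dist \<Omega> K = (\<lambda>x. if x \<in> \<Omega> then w x else 0)"
  unfolding stationary_dist_def
proof (rule the_equality)
  have "(\<Sum>x\<in>\<Omega>. w x * K x y) = w y" if "y \<in> \<Omega>" for y
  proof -
    have "(\<Sum>x\<in>\<Omega>. w x * K x y) = w y * app (\<lambda>_. 1) y"
      using that by (simp add: app_def sum_distrib_left reversible)
    then show ?thesis using app_one[OF that] by simp
  qed
  then show "is_stationary \<Omega> K (\<lambda>x. if x \<in> \<Omega> then w x else 0)"
    using weight_sum weight_pos by (auto simp: is_stationary_def less_imp_le)
next
  fix p assume p: "is_stationary \<Omega> K p"
  define f where "f x = p x / w x - 1" for x
  have f: "w x * f x = p x - w x" if "x \<in> \<Omega>" for x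
    using weight_pos[OF that] by (simp add: f_def field_simps)
  have "ip f (\<lambda>_. 1) = sum p \<Omega> - sum w \<Omega>"
    by (simp add: ip_def f sum_subtractf)
  then have "ip f (\<lambda>_. 1) = 0" using p weight_sum by (simp add: is_stationary_def)
  then have "ip (app f) (app f) \<le> c\<^sup>2 * ip f f" by (rule contraction)
  moreover have "app f x = f x" if x: "x \<in> \<Omega>" for x
  proof -
    have "w x * app f x = (\<Sum>y\<in>\<Omega>. (w y * f y) * K y x)"
      unfolding app_def sum_distrib_left using x
      by (intro sum.cong refl) (metis mult.assoc mult.commute reversible)
    also have "\<dots> = (\<Sum>y\<in>\<Omega>. p y * K y x) - (\<Sum>y\<in>\<Omega>. w y * K y x)"
      by (simp add: f left_diff_distrib sum_subtractf)
    also have "(\<Sum>y\<in>\<Omega>. w y * K y x) = w x * app (\<lambda>_. 1) x"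
      using x by (simp add: app_def sum_distrib_left reversible)
    also have "(\<Sum>y\<in>\<Omega>. p y * K y x) = p x" using p x by (simp add: is_stationary_def)
    finally have "w x * app f x = w x * f x" using f[OF x] app_one[OF x] by simp
    then show ?thesis using weight_pos[OF x] by simp
  qed
  then have "ip (app f) (app f) = ip f f" by (intro ip_cong) auto
  moreover have "c\<^sup>2 < 1" using c_nonneg c_less by (simp add: power_less_one_iff)
  ultimately have "ip f f = 0"
    using ip_nonneg[of f] mult_less_cancel_right2[of "c\<^sup>2" "ip f f"] by linarith
  then have "p x = w x" if "x \<in> \<Omega>" for x
    using ip_eq_0D[of f x] f[OF that] that by simp
  then show "p = (\<lambda>x. if x \<in> \<Omega> then w x else 0)"
    using p by (auto simp: is_stationary_def fun_eq_iff)
qed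

lemma l1_dist_kernel_power_le:
  assumes x: "x \<in> \<Omega>"
  shows "l1_dist \<Omega> (kernel_power \<Omega> K t x) (stationary_dist \<Omega> K) \<le> c ^ t * sqrt (1 / w x - 1)"
proof -
  \<comment> \<open>By reversibility this is the relative error
    \<open>kernel_power \<Omega> K s x y / w y - 1\<close> of the distribution at time
    \<open>s\<close>. With \<open>x\<close> as the end point it evolves under
    \<open>app\<close>.\<close>
  define g where "g s y = kernel_power \<Omega> K s y x / w x - 1" for s y
  have wx: "w x > 0" by (rule weight_pos[OF x])
  have step: "g (Suc s) y = app (g s) y" if "y \<in> \<Omega>" for s y
  proof -
    have "app (g s) y = (\<Sum>z\<in>\<Omega>. K y z * kernel_power \<Omega> K s z x / w x - K y z * 1)"
      by (simp add: app_def g_def right_diff_distrib)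
    also have "\<dots> = (\<Sum>z\<in>\<Omega>. K y z * kernel_power \<Omega> K s z x) / w x - app (\<lambda>_. 1) y"
      by (simp only: sum_subtractf sum_divide_distrib app_def)
    finally show ?thesis using that by (simp add: g_def app_one)
  qed
  have mean: "ip (g s) (\<lambda>_. 1) = 0" for s
  proof (induction s)
    case 0
    have "ip (g 0) (\<lambda>_. 1) = (\<Sum>y\<in>\<Omega>. (if y = x then 1 else 0) - w y)"
      unfolding ip_def using wx by (intro sum.cong refl) (auto simp: g_def field_simps)
    then show ?case using x fin by (simp add: sum_subtractf weight_sum)
  next
    case (Suc s)
    have "ip (g (Suc s)) (\<lambda>_. 1) = ip (app (g s)) (\<lambda>_. 1)" by (intro ip_cong step refl)
    then show ?case using Suc ip_app_one by simp
  qed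
  \<comment> \<open>The squared norm is the chi-squared distance to stationarity; for the point mass
    at \<open>x\<close> it equals \<open>1 / w x - 1\<close>.\<close>
  have norm: "ip (g s) (g s) \<le> (c ^ s)\<^sup>2 * (1 / w x - 1)" for s
  proof (induction s)
    case 0
    have "ip (g 0) (g 0) = (\<Sum>y\<in>\<Omega>. (if y = x then 1 / w x - 2 else 0) + w y)"
      unfolding ip_def using wx by (intro sum.cong refl) (auto simp: g_def field_simps)
    then show ?case using x fin by (simp add: sum.distrib weight_sum)
  next
    case (Suc s)
    have "ip (g (Suc s)) (g (Suc s)) = ip (app (g s)) (app (g s))" by (intro ip_cong step)
    also have "\<dots> \<le> c\<^sup>2 * ip (g s) (g s)" by (rule contraction[OF mean])
    also have "\<dots> \<le> c\<^sup>2 * ((c ^ s)\<^sup>2 * (1 / w x - 1))" by (intro mult_left_mono Suc) simp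
    finally show ?case by (simp add: power_mult_distrib mult_ac)
  qed
  have "l1_dist \<Omega> (kernel_power \<Omega> K t x) (stationary_dist \<Omega> K) = ip (\<lambda>y. \<bar>g t y\<bar>) (\<lambda>_. 1)"
    unfolding l1_dist_def ip_def stationary_dist_eq
  proof (intro sum.cong refl)
    fix y assume y: "y \<in> \<Omega>"
    have "w y * g t y = w y * kernel_power \<Omega> K t y x / w x - w y"
      by (simp add: g_def right_diff_distrib)
    also have "\<dots> = kernel_power \<Omega> K t x y - w y"
      using kernel_power_reversible[OF y x, of t] wx by simp
    finally have "\<bar>kernel_power \<Omega> K t x y - w y\<bar> = \<bar>w y * g t y\<bar>" by simp
    then show "\<bar>kernel_power \<Omega> K t x y - (if y \<in> \<Omega> then w y else 0)\<bar> = w y * \<bar>g t y\<bar> * 1"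
      using y weight_pos[OF y] by (simp add: abs_mult)
  qed
  \<comment> \<open>Cauchy-Schwarz against the constant 1, which has norm 1 because the weights sum
    to 1.\<close>
  moreover have "(ip (\<lambda>y. \<bar>g t y\<bar>) (\<lambda>_. 1))\<^sup>2 \<le> ip (g t) (g t)"
    using weighted_Cauchy_Schwarz[of \<Omega> w "\<lambda>y. \<bar>g t y\<bar>" "\<lambda>_. 1"] weight_pos weight_sum
    by (simp add: ip_def less_imp_le mult.assoc)
  ultimately have "(l1_dist \<Omega> (kernel_power \<Omega> K t x) (stationary_dist \<Omega> K))\<^sup>2 \<le> (c ^ t)\<^sup>2 * (1 / w x - 1)"
    using norm[of t] by simp
  then have "l1_dist \<Omega> (kernel_power \<Omega> K t x) (stationary_dist \<Omega> K) \<le> sqrt ((c ^ t)\<^sup>2 * (1 / w x - 1))"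
    by (rule real_le_rsqrt)
  then show ?thesis using c_nonneg by (simp add: real_sqrt_mult)
qed

end

section \<open>Derivatives of the generating polynomial\<close>

text \<open>This is \<open>gen_poly\<close> differentiated once in each variable of
  \<open>R\<close>, that is, the generating polynomial of the link of \<open>R\<close>.\<close>

definition link_poly :: "nat \<Rightarrow> (nat set \<Rightarrow> real) \<Rightarrow> nat set \<Rightarrow> (nat \<Rightarrow> real) \<Rightarrow> real" where
  "link_poly n \<mu> R x = (\<Sum>S | S \<subseteq> {1..n} \<and> R \<subseteq> S. \<mu> S * (\<Prod>i\<in>S - R. x i))"

definition mass :: "nat \<Rightarrow> (nat set \<Rightarrow> real) \<Rightarrow> nat set \<Rightarrow> real" where
  "mass n \<mu> R = (\<Sum>S | S \<subseteq> {1..n} \<and> R \<subseteq> S. \<mu> S)"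

lemma link_poly_one: "link_poly n \<mu> R (\<lambda>_. 1) = mass n \<mu> R"
  by (simp add: link_poly_def mass_def)

lemma link_poly_empty: "link_poly n \<mu> {} = gen_poly n \<mu>"
  by (simp add: link_poly_def gen_poly_def fun_eq_iff Pow_def)

lemma link_poly_upd_mem: "i \<in> R \<Longrightarrow> link_poly n \<mu> R (x(i := t)) = link_poly n \<mu> R x"
  unfolding link_poly_def by (intro sum.cong refl arg_cong[of _ _ "(*) _"] prod.cong) auto

text \<open>Every monomial contains a given variable to power at most one, so the polynomial is
  affine in it. The derivative is then the slope.\<close>

lemma link_poly_upd:
  assumes "i \<notin> R"
  shows "link_poly n \<mu> R (x(i := t)) = link_poly n \<mu> R (x(i := 0)) + t * link_poly n \<mu> (insert i R) x"
proof -
  let ?A = "{S. S \<subseteq> {1..n} \<and> R \<subseteq> S}"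
  have fin: "finite ?A" by (rule finite_subset[of _ "Pow {1..n}"]) auto
  have "(\<Prod>l\<in>S - R. (x(i := t)) l)
      = (\<Prod>l\<in>S - R. (x(i := 0)) l) + (if i \<in> S then t * (\<Prod>l\<in>S - insert i R. x l) else 0)"
    if S: "S \<in> ?A" for S
  proof (cases "i \<in> S")
    case True
    have fS: "finite (S - R)" using S finite_subset by fastforce
    have "(\<Prod>l\<in>S - R. (x(i := s)) l) = s * (\<Prod>l\<in>S - insert i R. x l)" for s
    proof -
      have "(\<Prod>l\<in>S - R. (x(i := s)) l) = (x(i := s)) i * (\<Prod>l\<in>(S - R) - {i}. (x(i := s)) l)"
        using True assms fS by (intro prod.remove) auto
      also have "(S - R) - {i} = S - insert i R" by auto
      also have "(\<Prod>l\<in>S - insert i R. (x(i := s)) l) = (\<Prod>l\<in>S - insert i R. x l)"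
        by (intro prod.cong) auto
      finally show ?thesis by simp
    qed
    then show ?thesis using True by simp
  next
    case False
    then show ?thesis by (auto intro!: prod.cong)
  qed
  then have "link_poly n \<mu> R (x(i := t)) = (\<Sum>S\<in>?A. \<mu> S * (\<Prod>l\<in>S - R. (x(i := 0)) l)
      + (if i \<in> S then t * (\<mu> S * (\<Prod>l\<in>S - insert i R. x l)) else 0))"
    unfolding link_poly_def by (intro sum.cong refl) (simp add: algebra_simps)
  also have "\<dots> = link_poly n \<mu> R (x(i := 0))
      + (\<Sum>S | S \<in> ?A \<and> i \<in> S. t * (\<mu> S * (\<Prod>l\<in>S - insert i R. x l)))"
    unfolding link_poly_def sum.distrib using fin by (simp only: sum.inter_filter)
  also have "{S. S \<in> ?A \<and> i \<in> S} = {S. S \<subseteq> {1..n} \<and> insert i R \<subseteq> S}" by auto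
  finally show ?thesis by (simp add: link_poly_def sum_distrib_left)
qed

lemma has_derivative_link_poly_upd:
  assumes "i \<notin> R"
  shows "((\<lambda>t. link_poly n \<mu> R (x(i := t))) has_real_derivative link_poly n \<mu> (insert i R) x) (at s)"
  by (subst link_poly_upd[OF assms]) (auto intro!: derivative_eq_intros)

lemma partial_link_poly: "i \<notin> R \<Longrightarrow> partial i (link_poly n \<mu> R) = link_poly n \<mu> (insert i R)"
  by (auto simp: partial_def fun_eq_iff intro!: DERIV_imp_deriv has_derivative_link_poly_upd)

lemma foldr_partial_gen_poly:
  "distinct is \<Longrightarrow> foldr partial is (gen_poly n \<mu>) = link_poly n \<mu> (set is)"
  by (induction "is") (simp_all add: link_poly_empty partial_link_poly)

lemma partial_ln_link_poly:
  assumes "j \<notin> R" "link_poly n \<mu> R x > 0"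
  shows "partial j (\<lambda>x. ln (link_poly n \<mu> R x)) x = link_poly n \<mu> (insert j R) x / link_poly n \<mu> R x"
  unfolding partial_def using assms
  by (auto intro!: DERIV_imp_deriv derivative_eq_intros has_derivative_link_poly_upd)

text \<open>The quotient rule for the logarithmic derivative. The second derivative is zero on the
  diagonal because the slope in a variable no longer involves that variable.\<close>

lemma hessian_ln_link_poly:
  assumes "i \<notin> R" "j \<notin> R" and pos: "mass n \<mu> R > 0"
  shows "hessian (\<lambda>x. ln (link_poly n \<mu> R x)) (\<lambda>_. 1) i j =
    (mass n \<mu> R * (if i = j then 0 else mass n \<mu> (insert i (insert j R)))
      - mass n \<mu> (insert i R) * mass n \<mu> (insert j R)) / (mass n \<mu> R)\<^sup>2"
proof -
  let ?x = "\<lambda>t. (\<lambda>_::nat. 1::real)(i := t)"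
  let ?q = "if i = j then 0 else mass n \<mu> (insert i (insert j R))"
  have at1: "?x 1 = (\<lambda>_. 1)" by auto
  have d1: "((\<lambda>t. link_poly n \<mu> R (?x t)) has_real_derivative mass n \<mu> (insert i R)) (at 1)"
    using has_derivative_link_poly_upd[OF assms(1)] by (simp add: link_poly_one[symmetric])
  have d2: "((\<lambda>t. link_poly n \<mu> (insert j R) (?x t)) has_real_derivative ?q) (at 1)"
  proof (cases "i = j")
    case True
    then show ?thesis by (simp add: link_poly_upd_mem)
  next
    case False
    then show ?thesis
      using has_derivative_link_poly_upd[of i "insert j R"] assms(1) by (simp add: link_poly_one[symmetric])
  qed
  \<comment> \<open>The formula for the logarithmic derivative requires a positive polynomial, and
    differentiating it again requires the formula on a whole neighbourhood of 1.\<close>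
  have "((\<lambda>t. link_poly n \<mu> R (?x t)) \<longlongrightarrow> link_poly n \<mu> R (?x 1)) (nhds 1)"
    using DERIV_isCont[OF d1] tendsto_at_iff_tendsto_nhds[of "\<lambda>t. link_poly n \<mu> R (?x t)" 1]
    by (simp add: isCont_def)
  then have ev: "\<forall>\<^sub>F t in nhds 1. link_poly n \<mu> R (?x t) > 0"
    using pos by (intro order_tendstoD) (simp_all add: at1 link_poly_one)
  have "((\<lambda>t. link_poly n \<mu> (insert j R) (?x t) / link_poly n \<mu> R (?x t)) has_real_derivative
    (?q * mass n \<mu> R - mass n \<mu> (insert j R) * mass n \<mu> (insert i R)) / (mass n \<mu> R * mass n \<mu> R)) (at 1)"
    using DERIV_divide[OF d2 d1] pos by (simp add: at1 link_poly_one)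
  then have "((\<lambda>t. partial j (\<lambda>x. ln (link_poly n \<mu> R x)) (?x t)) has_real_derivative
    (?q * mass n \<mu> R - mass n \<mu> (insert j R) * mass n \<mu> (insert i R)) / (mass n \<mu> R * mass n \<mu> R)) (at 1)"
    by (rule iffD1[OF DERIV_cong_ev, rotated -1])
      (use ev in \<open>auto elim!: eventually_mono simp: partial_ln_link_poly assms\<close>)
  then show ?thesis
    unfolding hessian_def by (subst partial_def) (simp add: DERIV_imp_deriv power2_eq_square mult.commute)
qed

section \<open>Log-concavity on the tangent space\<close>

lemma mass_nonneg: "prob_dist n \<mu> \<Longrightarrow> 0 \<le> mass n \<mu> R"
  by (auto simp: mass_def prob_dist_def intro!: sum_nonneg)

lemma mass_antimono:
  assumes "prob_dist n \<mu>" "R \<subseteq> R'"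
  shows "mass n \<mu> R' \<le> mass n \<mu> R"
proof -
  have "finite {S. S \<subseteq> {1..n} \<and> R \<subseteq> S}" by (rule finite_subset[of _ "Pow {1..n}"]) auto
  then show ?thesis
    unfolding mass_def using assms by (intro sum_mono2) (auto simp: prob_dist_def)
qed

text \<open>The Hessian of \<open>ln p\<close> is the Hessian of \<open>p\<close> divided by
  \<open>p\<close>, minus a rank-one form built from the gradient of \<open>p\<close>. On vectors
  orthogonal to the gradient the rank-one form vanishes.\<close>

lemma mass_hessian_nonpos_on_tangent:
  assumes prob: "prob_dist n \<mu>"
    and slc: "strongly_log_concave_at_one n (gen_poly n \<mu>)"
    and R: "R \<subseteq> {1..n}"
    and tangent: "(\<Sum>i\<in>{1..n} - R. mass n \<mu> (insert i R) * u i) = 0"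
  shows "(\<Sum>i\<in>{1..n} - R. \<Sum>j\<in>{1..n} - R - {i}. mass n \<mu> (insert i (insert j R)) * u i * u j) \<le> 0"
proof (cases "mass n \<mu> R = 0")
  case True
  \<comment> \<open>Here the polynomial is identically zero and log-concavity carries no
    information, but the quadratic form is zero too.\<close>
  then have "mass n \<mu> (insert i (insert j R)) = 0" for i j
    using mass_antimono[OF prob, of R "insert i (insert j R)"] mass_nonneg[OF prob]
    by (metis order_antisym subset_insertI2 subset_insertI subset_trans)
  then show ?thesis by simp
next
  case False
  then have pos: "mass n \<mu> R > 0" using mass_nonneg[OF prob, of R] by simp
  let ?N = "{1..n} - R"
  let ?p = "mass n \<mu> R" and ?H = "hessian (\<lambda>x. ln (link_poly n \<mu> R x)) (\<lambda>_. 1)"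
  let ?q = "\<lambda>i j. if i = j then 0 else mass n \<mu> (insert i (insert j R))"
  obtain xs where xs: "set xs = R" "distinct xs"
    using finite_distinct_list[of R] R finite_subset by blast
  have "log_concave_at_one n (link_poly n \<mu> R)"
    using slc R xs foldr_partial_gen_poly[OF xs(2)] by (metis strongly_log_concave_at_one_def)
  moreover have "\<not> (\<forall>x. link_poly n \<mu> R x = 0)" using False link_poly_one by metis
  ultimately have "neg_semidef n ?H" by (auto simp: log_concave_at_one_def)
  \<comment> \<open>Log-concavity concerns all \<open>n\<close> coordinates; extending
    \<open>u\<close> by zero on \<open>R\<close> restricts the form to the variables of the
    link.\<close>
  define v where "v i = (if i \<in> R then 0 else u i)" for i
  have restrict: "(\<Sum>i=1..n. \<Sum>j=1..n. v i * A i j * v j) = (\<Sum>i\<in>?N. \<Sum>j\<in>?N. u i * A i j * u j)" for A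
  proof -
    have "(\<Sum>i=1..n. \<Sum>j=1..n. v i * A i j * v j) = (\<Sum>i\<in>?N. \<Sum>j=1..n. v i * A i j * v j)"
      by (rule sum.mono_neutral_right) (auto simp: v_def)
    also have "\<dots> = (\<Sum>i\<in>?N. \<Sum>j\<in>?N. v i * A i j * v j)"
      by (intro sum.cong refl sum.mono_neutral_right) (auto simp: v_def)
    also have "\<dots> = (\<Sum>i\<in>?N. \<Sum>j\<in>?N. u i * A i j * u j)"
      by (intro sum.cong refl) (auto simp: v_def)
    finally show ?thesis .
  qed
  have "0 \<ge> (\<Sum>i\<in>?N. \<Sum>j\<in>?N. u i * ?H i j * u j)"
    using \<open>neg_semidef n ?H\<close> unfolding neg_semidef_def restrict[symmetric] by blast
  also have "(\<Sum>i\<in>?N. \<Sum>j\<in>?N. u i * ?H i j * u j)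
    = (\<Sum>i\<in>?N. \<Sum>j\<in>?N. ?q i j * u i * u j / ?p
        - (mass n \<mu> (insert i R) * u i) * (mass n \<mu> (insert j R) * u j) / ?p\<^sup>2)"
    using pos by (intro sum.cong refl, subst hessian_ln_link_poly) (auto simp: field_simps power2_eq_square)
  also have "\<dots> = (\<Sum>i\<in>?N. \<Sum>j\<in>?N. ?q i j * u i * u j) / ?p
      - (\<Sum>i\<in>?N. mass n \<mu> (insert i R) * u i) * (\<Sum>j\<in>?N. mass n \<mu> (insert j R) * u j) / ?p\<^sup>2"
    by (simp only: sum_subtractf sum_divide_distrib sum_product)
  finally have "(\<Sum>i\<in>?N. \<Sum>j\<in>?N. ?q i j * u i * u j) \<le> 0"
    using tangent pos by (simp add: divide_le_0_iff)
  also have "(\<Sum>i\<in>?N. \<Sum>j\<in>?N. ?q i j * u i * u j)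
    = (\<Sum>i\<in>?N. \<Sum>j\<in>?N - {i}. mass n \<mu> (insert i (insert j R)) * u i * u j)"
    by (intro sum.cong refl sum.mono_neutral_cong_right) auto
  finally show ?thesis .
qed

section \<open>Walks between levels\<close>

locale slc_distribution =
  fixes n d :: nat and \<mu> :: "nat set \<Rightarrow> real"
  assumes d_pos: "1 \<le> d"
    and prob: "prob_dist n \<mu>"
    and homog: "homogeneous n d \<mu>"
    and slc: "strongly_log_concave_at_one n (gen_poly n \<mu>)"
begin

definition level :: "nat \<Rightarrow> nat set set" where
  "level j = {T. T \<subseteq> {1..n} \<and> card T = j}"

definition weight :: "nat set \<Rightarrow> real" where
  "weight T = fact (d - card T) * mass n \<mu> T"

text \<open>Division by zero gives the value 0 on sets of weight zero. This is what later makes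
  vanishing conditions automatic outside the faces.\<close>

definition down :: "(nat set \<Rightarrow> real) \<Rightarrow> nat set \<Rightarrow> real" where
  "down g T = (\<Sum>i\<in>{1..n} - T. weight (insert i T) * g (insert i T)) / weight T"

definition up :: "(nat set \<Rightarrow> real) \<Rightarrow> nat set \<Rightarrow> real" where
  "up h S = (\<Sum>i\<in>S. h (S - {i}))"

definition level_ip :: "nat \<Rightarrow> (nat set \<Rightarrow> real) \<Rightarrow> (nat set \<Rightarrow> real) \<Rightarrow> real" where
  "level_ip j f g = (\<Sum>T\<in>level j. weight T * f T * g T)"

section \<open>Weights of faces and double counting between levels\<close>

lemma finite_level: "finite (level j)"
  by (rule finite_subset[of _ "Pow {1..n}"]) (auto simp: level_def)

lemma finite_member_level: "T \<in> level j \<Longrightarrow> finite T"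
  by (auto simp: level_def intro: finite_subset)

lemma card_support: "S \<subseteq> {1..n} \<Longrightarrow> \<mu> S \<noteq> 0 \<Longrightarrow> card S = d"
  using prob homog unfolding prob_dist_def homogeneous_def by (metis order_less_le)

text \<open>Double counting: a set \<open>S\<close> of the support containing \<open>T\<close> is
  counted once for each element of \<open>S - T\<close>, and every such \<open>S\<close> has size
  \<open>d\<close>.\<close>

lemma sum_mass_insert:
  assumes T: "T \<subseteq> {1..n}"
  shows "(\<Sum>i\<in>{1..n} - T. mass n \<mu> (insert i T)) = real (d - card T) * mass n \<mu> T"
proof -
  let ?A = "{S. S \<subseteq> {1..n} \<and> T \<subseteq> S}"
  have fin: "finite ?A" by (rule finite_subset[of _ "Pow {1..n}"]) auto
  have "mass n \<mu> (insert i T) = (\<Sum>S\<in>?A. if i \<in> S then \<mu> S else 0)" for i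
  proof -
    have "{S. S \<subseteq> {1..n} \<and> insert i T \<subseteq> S} = {S \<in> ?A. i \<in> S}" by auto
    then show ?thesis unfolding mass_def using fin by (simp only: sum.inter_filter)
  qed
  then have "(\<Sum>i\<in>{1..n} - T. mass n \<mu> (insert i T))
      = (\<Sum>i\<in>{1..n} - T. \<Sum>S\<in>?A. if i \<in> S then \<mu> S else 0)"
    by (simp only:)
  also have "\<dots> = (\<Sum>S\<in>?A. \<Sum>i\<in>{1..n} - T. if i \<in> S then \<mu> S else 0)"
    by (rule sum.swap)
  also have "\<dots> = (\<Sum>S\<in>?A. real (d - card T) * \<mu> S)"
  proof (intro sum.cong refl)
    fix S assume S: "S \<in> ?A"
    have "(\<Sum>i\<in>{1..n} - T. if i \<in> S then \<mu> S else 0) = (\<Sum>i\<in>{i \<in> {1..n} - T. i \<in> S}. \<mu> S)"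
      by (rule sum.inter_filter[symmetric]) simp
    also have "{i \<in> {1..n} - T. i \<in> S} = S - T" using S by auto
    also have "(\<Sum>i\<in>S - T. \<mu> S) = real (card S - card T) * \<mu> S"
      using S T by (simp add: card_Diff_subset finite_subset[of T])
    also have "\<dots> = real (d - card T) * \<mu> S" using card_support[of S] S by auto
    finally show "(\<Sum>i\<in>{1..n} - T. if i \<in> S then \<mu> S else 0) = real (d - card T) * \<mu> S" .
  qed
  finally show ?thesis by (simp add: mass_def sum_distrib_left)
qed

lemma weight_nonneg: "0 \<le> weight T"
  by (simp add: weight_def mass_nonneg[OF prob])

lemma weight_insert_eq_0: "weight T = 0 \<Longrightarrow> weight (insert i T) = 0"
  using mass_antimono[OF prob, of T "insert i T"] mass_nonneg[OF prob, of "insert i T"]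
  by (auto simp: weight_def)

text \<open>The factor from \<open>sum_mass_insert\<close> completes the factorial. This stops below
  the top level, where no larger set lies in the support.\<close>

lemma sum_weight_insert:
  assumes T: "T \<subseteq> {1..n}" and card: "card T < d"
  shows "(\<Sum>i\<in>{1..n} - T. weight (insert i T)) = weight T"
proof -
  have finT: "finite T" using T finite_subset by blast
  have "(\<Sum>i\<in>{1..n} - T. weight (insert i T))
      = (\<Sum>i\<in>{1..n} - T. fact (d - Suc (card T)) * mass n \<mu> (insert i T))"
    using finT by (intro sum.cong refl) (simp add: weight_def)
  also have "\<dots> = fact (d - Suc (card T)) * (real (d - card T) * mass n \<mu> T)"
    using sum_mass_insert[OF T] by (simp flip: sum_distrib_left)
  also have "\<dots> = weight T"
    using card by (simp add: weight_def fact_reduce[of "d - card T"] mult_ac)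
  finally show ?thesis .
qed

text \<open>The denominator can be cleared even where it is zero, since then all covering sets have
  weight zero as well.\<close>

lemma weight_times_down:
  "weight T * down g T = (\<Sum>i\<in>{1..n} - T. weight (insert i T) * g (insert i T))"
  by (cases "weight T = 0") (simp_all add: down_def weight_insert_eq_0)

text \<open>A set with a marked element corresponds to the set without it together with an element
  outside. All rearrangements of sums between adjacent levels go through this bijection.\<close>

lemma sum_level_Suc:
  fixes F :: "nat set \<Rightarrow> nat \<Rightarrow> real"
  shows "(\<Sum>S\<in>level (Suc j). \<Sum>i\<in>S. F (S - {i}) i) = (\<Sum>T\<in>level j. \<Sum>i\<in>{1..n} - T. F T i)"
proof -
  have "(\<Sum>S\<in>level (Suc j). \<Sum>i\<in>S. F (S - {i}) i)
      = (\<Sum>(S, i)\<in>(SIGMA S:level (Suc j). S). F (S - {i}) i)"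
    using finite_level finite_member_level by (intro sum.Sigma) auto
  also have "\<dots> = (\<Sum>(T, i)\<in>(SIGMA T:level j. {1..n} - T). F T i)"
    by (rule sum.reindex_bij_witness[of _ "\<lambda>(T, i). (insert i T, i)" "\<lambda>(S, i). (S - {i}, i)"])
      (auto simp: level_def insert_absorb finite_subset[OF _ finite_atLeastAtMost] card_insert_if)
  also have "\<dots> = (\<Sum>T\<in>level j. \<Sum>i\<in>{1..n} - T. F T i)"
    using finite_level by (intro sum.Sigma[symmetric]) auto
  finally show ?thesis .
qed

section \<open>Adjoint walks and the local-to-global inequality\<close>

lemma level_ip_nonneg: "0 \<le> level_ip j f f"
  unfolding level_ip_def by (intro sum_nonneg) (simp add: weight_nonneg mult.assoc)

lemma level_ip_Cauchy_Schwarz: "(level_ip j f g)\<^sup>2 \<le> level_ip j f f * level_ip j g g"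
  unfolding level_ip_def by (intro weighted_Cauchy_Schwarz weight_nonneg)

lemma level_ip_down: "level_ip j (down g) h = level_ip (Suc j) g (up h)"
proof -
  have "level_ip (Suc j) g (up h)
      = (\<Sum>S\<in>level (Suc j). \<Sum>i\<in>S. weight (insert i (S - {i})) * g (insert i (S - {i})) * h (S - {i}))"
    unfolding level_ip_def up_def sum_distrib_left
    by (intro sum.cong refl) (simp add: insert_absorb)
  also have "\<dots> = (\<Sum>T\<in>level j. \<Sum>i\<in>{1..n} - T. weight (insert i T) * g (insert i T) * h T)"
    by (rule sum_level_Suc)
  also have "\<dots> = level_ip j (down g) h"
    by (simp add: level_ip_def weight_times_down sum_distrib_right)
  finally show ?thesis by simp
qed

text \<open>
  Negativity on the tangent space upgrades to this bound because, by homogeneity, the constant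
  vector is mapped by the quadratic form to the gradient.
\<close>

lemma local_form_le:
  assumes R: "R \<subseteq> {1..n}" and card: "card R + 2 \<le> d"
  shows "(\<Sum>k\<in>{1..n} - R. \<Sum>i\<in>{1..n} - R - {k}. weight (insert i (insert k R)) * v k * v i)
    \<le> weight R * (\<Sum>i\<in>{1..n} - R. weight (insert i R) * v i / weight R)\<^sup>2"
proof (cases "weight R = 0")
  case True
  then have "weight (insert i (insert k R)) = 0" for i k by (simp add: weight_insert_eq_0)
  then show ?thesis using True by simp
next
  case False
  let ?N = "{1..n} - R"
  have finR: "finite R" using R finite_subset by blast
  \<comment> \<open>The mean of \<open>v\<close> under the normalised weights of the sets covering
    \<open>R\<close>; subtracting it moves \<open>v\<close> into the tangent space.\<close>
  define c where "c = (\<Sum>i\<in>?N. weight (insert i R) * v i / weight R)"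
  have c: "(\<Sum>i\<in>?N. weight (insert i R) * v i) = c * weight R"
    using False by (simp add: c_def flip: sum_divide_distrib)
  define q where "q k i = weight (insert i (insert k R))" for k i
  have q_commute: "q k i = q i k" for k i by (simp add: q_def insert_commute)
  have row: "(\<Sum>i\<in>?N - {k}. q k i) = weight (insert k R)" if "k \<in> ?N" for k
  proof -
    have "?N - {k} = {1..n} - insert k R" by auto
    then show ?thesis unfolding q_def
      using sum_weight_insert[of "insert k R"] R that card finR by simp
  qed
  have total: "(\<Sum>k\<in>?N. weight (insert k R)) = weight R"
    using sum_weight_insert[OF R] card by simp
  define u where "u i = v i - c" for i
  have "(\<Sum>i\<in>?N. weight (insert i R) * u i) = 0"
    using c total by (simp add: u_def right_diff_distrib sum_subtractf flip: sum_distrib_right)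
  moreover have "(\<Sum>i\<in>?N. weight (insert i R) * u i)
      = fact (d - Suc (card R)) * (\<Sum>i\<in>?N. mass n \<mu> (insert i R) * u i)"
    unfolding sum_distrib_left using finR by (intro sum.cong refl) (simp add: weight_def)
  ultimately have "(\<Sum>i\<in>?N. mass n \<mu> (insert i R) * u i) = 0" by simp
  then have "(\<Sum>i\<in>?N. \<Sum>j\<in>?N - {i}. mass n \<mu> (insert i (insert j R)) * u i * u j) \<le> 0"
    by (rule mass_hessian_nonpos_on_tangent[OF prob slc R])
  moreover have "(\<Sum>k\<in>?N. \<Sum>i\<in>?N - {k}. q k i * u k * u i)
      = fact (d - Suc (Suc (card R))) * (\<Sum>i\<in>?N. \<Sum>j\<in>?N - {i}. mass n \<mu> (insert i (insert j R)) * u i * u j)"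
    unfolding sum_distrib_left using finR
    by (intro sum.cong refl) (auto simp: weight_def q_def insert_commute)
  ultimately have neg: "(\<Sum>k\<in>?N. \<Sum>i\<in>?N - {k}. q k i * u k * u i) \<le> 0"
    by (simp add: mult_nonneg_nonpos)
  have swap: "(\<Sum>k\<in>?N. \<Sum>i\<in>?N - {k}. q k i * v i) = (\<Sum>k\<in>?N. \<Sum>i\<in>?N - {k}. q k i * v k)"
  proof -
    have "(\<Sum>k\<in>?N. \<Sum>i\<in>?N - {k}. q k i * v i) = (\<Sum>k\<in>?N. \<Sum>i | i \<in> ?N \<and> i \<noteq> k. q k i * v i)"
      by (intro sum.cong refl) auto
    also have "\<dots> = (\<Sum>i\<in>?N. \<Sum>k | k \<in> ?N \<and> i \<noteq> k. q k i * v i)"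
      by (rule sum.swap_restrict) auto
    also have "\<dots> = (\<Sum>i\<in>?N. \<Sum>k\<in>?N - {i}. q i k * v i)"
      by (intro sum.cong refl) (auto simp: q_commute)
    finally show ?thesis .
  qed
  have lin: "(\<Sum>k\<in>?N. \<Sum>i\<in>?N - {k}. q k i * v k) = c * weight R"
    unfolding c[symmetric] sum_distrib_right[symmetric] by (intro sum.cong refl) (simp only: row)
  have const: "(\<Sum>k\<in>?N. \<Sum>i\<in>?N - {k}. q k i) = weight R"
    unfolding total[symmetric] by (intro sum.cong refl) (simp only: row)
  \<comment> \<open>Expanding around the mean, the two linear terms and the constant term add up to
    \<open>- c\<^sup>2 * weight R\<close>.\<close>
  have "(\<Sum>k\<in>?N. \<Sum>i\<in>?N - {k}. q k i * u k * u i)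
      = (\<Sum>k\<in>?N. \<Sum>i\<in>?N - {k}. q k i * v k * v i - c * (q k i * v k) - c * (q k i * v i) + c\<^sup>2 * q k i)"
    by (intro sum.cong refl) (simp add: u_def algebra_simps power2_eq_square)
  also have "\<dots> = (\<Sum>k\<in>?N. \<Sum>i\<in>?N - {k}. q k i * v k * v i) - c * (c * weight R) - c * (c * weight R)
      + c\<^sup>2 * weight R"
    unfolding sum.distrib sum_subtractf
    unfolding sum_distrib_left[symmetric] swap lin const ..
  finally have "(\<Sum>k\<in>?N. \<Sum>i\<in>?N - {k}. q k i * v k * v i) \<le> weight R * c\<^sup>2"
    using neg by (simp add: power2_eq_square algebra_simps)
  then show ?thesis by (simp add: q_def c_def)
qed

text \<open>The square of \<open>up h S\<close> is expanded over pairs of removed elements. Equal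
  pairs give the norm of \<open>h\<close>; distinct pairs are grouped by the set \<open>R\<close>
  left after both removals, and each group is bounded by \<open>local_form_le\<close>.\<close>

lemma level_ip_up_le:
  assumes "j + 2 \<le> d"
  shows "level_ip (Suc (Suc j)) (up h) (up h) \<le> level_ip j (down h) (down h) + level_ip (Suc j) h h"
proof -
  have "level_ip (Suc (Suc j)) (up h) (up h)
      = (\<Sum>S\<in>level (Suc (Suc j)). (\<Sum>i\<in>S. weight S * (h (S - {i}))\<^sup>2)
          + (\<Sum>i\<in>S. \<Sum>k\<in>S - {i}. weight S * h (S - {i}) * h (S - {k})))"
    unfolding level_ip_def
  proof (intro sum.cong refl)
    fix S assume "S \<in> level (Suc (Suc j))"
    then have "finite S" by (rule finite_member_level)
    have "weight S * up h S * up h S = (\<Sum>i\<in>S. \<Sum>k\<in>S. weight S * h (S - {i}) * h (S - {k}))"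
      unfolding up_def mult.assoc by (subst sum_product) (simp add: sum_distrib_left)
    also have "\<dots> = (\<Sum>i\<in>S. weight S * (h (S - {i}))\<^sup>2 + (\<Sum>k\<in>S - {i}. weight S * h (S - {i}) * h (S - {k})))"
      using \<open>finite S\<close> by (intro sum.cong refl) (simp add: sum.remove power2_eq_square mult.assoc)
    finally show "weight S * up h S * up h S = (\<Sum>i\<in>S. weight S * (h (S - {i}))\<^sup>2)
        + (\<Sum>i\<in>S. \<Sum>k\<in>S - {i}. weight S * h (S - {i}) * h (S - {k}))"
      by (simp add: sum.distrib)
  qed
  also have "\<dots> = (\<Sum>S\<in>level (Suc (Suc j)). \<Sum>i\<in>S. weight S * (h (S - {i}))\<^sup>2)
      + (\<Sum>S\<in>level (Suc (Suc j)). \<Sum>i\<in>S. \<Sum>k\<in>S - {i}. weight S * h (S - {i}) * h (S - {k}))"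
    by (rule sum.distrib)
  also have "(\<Sum>S\<in>level (Suc (Suc j)). \<Sum>i\<in>S. weight S * (h (S - {i}))\<^sup>2)
      = (\<Sum>S\<in>level (Suc (Suc j)). \<Sum>i\<in>S. weight (insert i (S - {i})) * (h (S - {i}))\<^sup>2)"
    by (intro sum.cong refl) (simp add: insert_absorb)
  also have "\<dots> = (\<Sum>T\<in>level (Suc j). \<Sum>i\<in>{1..n} - T. weight (insert i T) * (h T)\<^sup>2)"
    by (rule sum_level_Suc)
  also have "\<dots> = level_ip (Suc j) h h"
    unfolding level_ip_def
  proof (intro sum.cong refl)
    fix T assume "T \<in> level (Suc j)"
    then show "(\<Sum>i\<in>{1..n} - T. weight (insert i T) * (h T)\<^sup>2) = weight T * h T * h T"
      using sum_weight_insert[of T] assms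
      by (simp add: level_def power2_eq_square mult.assoc flip: sum_distrib_right)
  qed
  also have "(\<Sum>S\<in>level (Suc (Suc j)). \<Sum>i\<in>S. \<Sum>k\<in>S - {i}. weight S * h (S - {i}) * h (S - {k}))
      = (\<Sum>S\<in>level (Suc (Suc j)). \<Sum>i\<in>S. \<Sum>k\<in>S - {i}.
          weight (insert i (S - {i})) * h (S - {i}) * h (insert i (S - {i}) - {k}))"
    by (intro sum.cong refl) (simp add: insert_absorb)
  also have "\<dots> = (\<Sum>T\<in>level (Suc j). \<Sum>i\<in>{1..n} - T. \<Sum>k\<in>T.
      weight (insert i T) * h T * h (insert i T - {k}))"
    by (rule sum_level_Suc)
  also have "\<dots> = (\<Sum>T\<in>level (Suc j). \<Sum>k\<in>T. \<Sum>i\<in>{1..n} - T.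
      weight (insert i T) * h T * h (insert i T - {k}))"
    by (intro sum.cong refl sum.swap)
  \<comment> \<open>The summand is rewritten through \<open>T - {k}\<close> so that
    \<open>sum_level_Suc\<close> can descend a second level.\<close>
  also have "\<dots> = (\<Sum>T\<in>level (Suc j). \<Sum>k\<in>T. \<Sum>i\<in>{1..n} - insert k (T - {k}).
      weight (insert i (insert k (T - {k}))) * h (insert k (T - {k})) * h (insert i (T - {k})))"
  proof (intro sum.cong)
    fix T k i assume "k \<in> T" "i \<in> {1..n} - insert k (T - {k})"
    then have "insert k (T - {k}) = T" "insert i T - {k} = insert i (T - {k})" by auto
    then show "weight (insert i T) * h T * h (insert i T - {k})
      = weight (insert i (insert k (T - {k}))) * h (insert k (T - {k})) * h (insert i (T - {k}))" by simp
  qed auto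
  also have "\<dots> = (\<Sum>R\<in>level j. \<Sum>k\<in>{1..n} - R. \<Sum>i\<in>{1..n} - insert k R.
      weight (insert i (insert k R)) * h (insert k R) * h (insert i R))"
    by (rule sum_level_Suc)
  also have "\<dots> \<le> level_ip j (down h) (down h)"
    unfolding level_ip_def
  proof (intro sum_mono)
    fix R assume "R \<in> level j"
    then have R: "R \<subseteq> {1..n}" "card R + 2 \<le> d" using assms by (auto simp: level_def)
    have "{1..n} - insert k R = {1..n} - R - {k}" for k by auto
    then show "(\<Sum>k\<in>{1..n} - R. \<Sum>i\<in>{1..n} - insert k R.
        weight (insert i (insert k R)) * h (insert k R) * h (insert i R)) \<le> weight R * down h R * down h R"
      using local_form_le[OF R, of "\<lambda>i. h (insert i R)"]
      by (simp add: down_def power2_eq_square sum_divide_distrib mult.assoc)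
  qed
  finally show ?thesis by simp
qed

text \<open>A bound for \<open>up\<close> passes to its adjoint: Cauchy-Schwarz bounds the square of
  the norm of \<open>down g\<close> by a multiple of that norm itself. Cancelling it requires a
  nonzero norm, hence the second alternative.\<close>

lemma level_ip_down_le:
  assumes "level_ip (Suc j) (up (down g)) (up (down g)) \<le> a * level_ip j (down g) (down g)"
  shows "level_ip j (down g) (down g) \<le> a * level_ip (Suc j) g g \<or> level_ip j (down g) (down g) = 0"
proof -
  let ?x = "level_ip j (down g) (down g)" and ?y = "level_ip (Suc j) g g"
  have "?x * ?x = (level_ip (Suc j) g (up (down g)))\<^sup>2"
    by (simp add: level_ip_down power2_eq_square)
  also have "\<dots> \<le> ?y * level_ip (Suc j) (up (down g)) (up (down g))"
    by (rule level_ip_Cauchy_Schwarz)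
  also have "\<dots> \<le> ?y * (a * ?x)" by (intro mult_left_mono assms level_ip_nonneg)
  finally have "?x * ?x \<le> (a * ?y) * ?x" by (simp add: mult_ac)
  then show ?thesis
    using level_ip_nonneg[of j "down g"] mult_le_cancel_right[of ?x ?x "a * ?y"] by linarith
qed

text \<open>On level \<open>k\<close> the function itself vanishes. Each further level transfers the
  constant from \<open>up\<close> to \<open>down\<close> by adjointness, and
  \<open>level_ip_up_le\<close> then adds 1 to it.\<close>

lemma up_contraction:
  assumes "k \<le> j" "j < d" "\<And>T. T \<in> level k \<Longrightarrow> (down ^^ (j - k)) h T = 0"
  shows "level_ip (Suc j) (up h) (up h) \<le> (real j - real k) * level_ip j h h"
  using assms
proof (induction j arbitrary: h rule: dec_induct)
  case base
  have "up h S = 0" if "S \<in> level (Suc k)" for S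
    unfolding up_def
  proof (intro sum.neutral ballI)
    fix i assume "i \<in> S"
    then have "S - {i} \<in> level k" using that finite_member_level[OF that] by (auto simp: level_def)
    then show "h (S - {i}) = 0" using base by simp
  qed
  then show ?case by (simp add: level_ip_def)
next
  case (step j)
  have "(down ^^ (j - k)) (down h) T = 0" if "T \<in> level k" for T
    using step.prems(2)[OF that] step.hyps by (simp add: Suc_diff_le funpow_swap1)
  then have "level_ip (Suc j) (up (down h)) (up (down h)) \<le> (real j - real k) * level_ip j (down h) (down h)"
    using step.prems(1) by (intro step.IH) auto
  from level_ip_down_le[OF this]
  have "level_ip j (down h) (down h) \<le> (real j - real k) * level_ip (Suc j) h h"
    using step.hyps level_ip_nonneg[of "Suc j" h] by auto
  then show ?case
    using level_ip_up_le[of j h] step.prems(1) by (simp add: algebra_simps)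
qed

lemma down_contraction:
  assumes "k \<le> j" "j < d" "\<And>T. T \<in> level k \<Longrightarrow> (down ^^ (Suc j - k)) g T = 0"
  shows "level_ip j (down g) (down g) \<le> (real j - real k) * level_ip (Suc j) g g"
proof -
  have "(down ^^ (j - k)) (down g) T = 0" if "T \<in> level k" for T
    using assms(3)[OF that] assms(1) by (simp add: Suc_diff_le funpow_swap1)
  then have "level_ip (Suc j) (up (down g)) (up (down g)) \<le> (real j - real k) * level_ip j (down g) (down g)"
    using assms by (intro up_contraction)
  from level_ip_down_le[OF this] show ?thesis
    using assms(1) level_ip_nonneg[of "Suc j" g] by auto
qed

lemma down_sum: "down (\<lambda>T. \<Sum>i\<in>I. c i * f i T) = (\<lambda>T. \<Sum>i\<in>I. c i * down (f i) T)"
proof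
  fix T
  have "(\<Sum>l\<in>{1..n} - T. weight (insert l T) * (\<Sum>i\<in>I. c i * f i (insert l T)))
      = (\<Sum>i\<in>I. c i * (\<Sum>l\<in>{1..n} - T. weight (insert l T) * f i (insert l T)))"
    unfolding sum_distrib_left by (subst sum.swap) (simp add: mult_ac)
  then show "down (\<lambda>T. \<Sum>i\<in>I. c i * f i T) T = (\<Sum>i\<in>I. c i * down (f i) T)"
    by (simp only: down_def sum_divide_distrib[of _ I] times_divide_eq_right)
qed

lemma funpow_down_sum:
  "(down ^^ m) (\<lambda>T. \<Sum>i\<in>I. c i * f i T) = (\<lambda>T. \<Sum>i\<in>I. c i * (down ^^ m) (f i) T)"
  by (induction m) (simp_all add: down_sum)

lemma level_ip_down_one: "level_ip j (down g) (\<lambda>_. 1) = real (Suc j) * level_ip (Suc j) g (\<lambda>_. 1)"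
proof -
  have "level_ip j (down g) (\<lambda>_. 1) = level_ip (Suc j) g (up (\<lambda>_. 1))" by (rule level_ip_down)
  also have "\<dots> = (\<Sum>T\<in>level (Suc j). real (Suc j) * (weight T * g T * 1))"
    unfolding level_ip_def by (intro sum.cong refl) (simp add: up_def level_def)
  finally show ?thesis by (simp only: level_ip_def sum_distrib_left)
qed

text \<open>Carries the mean-zero condition from the top level down to the empty face.\<close>

lemma level_ip_funpow_down_one:
  assumes "level_ip (j + m) g (\<lambda>_. 1) = 0"
  shows "level_ip j ((down ^^ m) g) (\<lambda>_. 1) = 0"
  using assms by (induction m arbitrary: j) (simp_all add: level_ip_down_one)

section \<open>The chain as a walk on the top level\<close>

lemma finite_supp: "finite (supp n \<mu>)"
  by (rule finite_subset[of _ "Pow {1..n}"]) (auto simp: supp_def)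

lemma supp_pos: "S \<in> supp n \<mu> \<Longrightarrow> 0 < \<mu> S"
  using prob unfolding supp_def prob_dist_def by (simp add: order_less_le)

lemma card_supp: "S \<in> supp n \<mu> \<Longrightarrow> card S = d"
  by (simp add: supp_def card_support)

lemma mass_eq_supp: "mass n \<mu> T = (\<Sum>S | S \<in> supp n \<mu> \<and> T \<subseteq> S. \<mu> S)"
  unfolding mass_def
  by (rule sum.mono_neutral_right)
    (auto simp: supp_def intro: finite_subset[of _ "Pow {1..n}"])

lemma mass_pos: "S \<in> supp n \<mu> \<Longrightarrow> T \<subseteq> S \<Longrightarrow> 0 < mass n \<mu> T"
  unfolding mass_eq_supp using finite_supp supp_pos
  by (intro sum_pos2[of _ S]) (auto simp: less_imp_le)

lemma mass_eq_0: "T \<subseteq> {1..n} \<Longrightarrow> T \<notin> faces n \<mu> (card T) \<Longrightarrow> mass n \<mu> T = 0"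
  unfolding mass_eq_supp by (rule sum.neutral) (auto simp: faces_def)

lemma weight_level_d: "S \<in> level d \<Longrightarrow> weight S = \<mu> S"
proof -
  assume S: "S \<in> level d"
  have "{S' \<in> supp n \<mu>. S \<subseteq> S'} = (if \<mu> S = 0 then {} else {S})"
  proof -
    have "S' = S" if "S' \<in> supp n \<mu>" "S \<subseteq> S'" for S'
      using that S card_supp[OF that(1)] card_subset_eq[of S' S] finite_subset[of S' "{1..n}"]
      by (auto simp: supp_def level_def)
    then show ?thesis using S by (auto simp: supp_def level_def)
  qed
  then show "weight S = \<mu> S" using S by (simp add: weight_def mass_eq_supp level_def)
qed

lemma level_ip_d: "level_ip d f g = (\<Sum>S\<in>supp n \<mu>. \<mu> S * f S * g S)"
proof -
  have "level_ip d f g = (\<Sum>S\<in>level d. \<mu> S * f S * g S)"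
    unfolding level_ip_def by (intro sum.cong refl) (simp add: weight_level_d)
  also have "\<dots> = (\<Sum>S\<in>supp n \<mu>. \<mu> S * f S * g S)"
    using finite_level card_supp by (intro sum.mono_neutral_right) (auto simp: level_def supp_def)
  finally show ?thesis .
qed

lemma down_level_pred:
  assumes T: "T \<subseteq> {1..n}" "Suc (card T) = d"
  shows "down f T = (\<Sum>S | S \<in> supp n \<mu> \<and> T \<subseteq> S. \<mu> S * f S) / mass n \<mu> T"
proof -
  have finT: "finite T" using T finite_subset by blast
  have "(\<Sum>i\<in>{1..n} - T. weight (insert i T) * f (insert i T))
      = (\<Sum>i\<in>{1..n} - T. \<mu> (insert i T) * f (insert i T))"
    using T finT by (intro sum.cong refl) (subst weight_level_d, auto simp: level_def)
  also have "\<dots> = (\<Sum>S\<in>(\<lambda>i. insert i T) ` ({1..n} - T). \<mu> S * f S)"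
    by (subst sum.reindex) (auto intro!: inj_onI)
  also have "\<dots> = (\<Sum>S | S \<in> supp n \<mu> \<and> T \<subseteq> S. \<mu> S * f S)"
  proof (rule sum.mono_neutral_right)
    show "{S \<in> supp n \<mu>. T \<subseteq> S} \<subseteq> (\<lambda>i. insert i T) ` ({1..n} - T)"
    proof
      fix S assume "S \<in> {S \<in> supp n \<mu>. T \<subseteq> S}"
      then have S: "S \<subseteq> {1..n}" "T \<subseteq> S" "card S = Suc (card T)"
        using card_supp T by (auto simp: supp_def)
      then have "card (S - T) = 1" using finT by (simp add: card_Diff_subset)
      then obtain i where "S - T = {i}" by (auto simp: card_1_singleton_iff)
      then have "S = insert i T" "i \<in> {1..n} - T" using S by auto
      then show "S \<in> (\<lambda>i. insert i T) ` ({1..n} - T)" by blast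
    qed
  qed (use T in \<open>auto simp: supp_def\<close>)
  moreover have "d - card T = 1" using T(2) by simp
  ultimately show ?thesis by (simp add: down_def weight_def)
qed

text \<open>Resampling above \<open>S - {i}\<close> proportionally to \<open>\<mu>\<close> is the
  average taken by \<open>down\<close> just below the top level, and each \<open>i\<close> is
  removed with probability \<open>1 / real d\<close>.\<close>

lemma chain_apply:
  assumes S: "S \<in> supp n \<mu>"
  shows "(\<Sum>S'\<in>supp n \<mu>. chain n \<mu> S S' * f S') = up (down f) S / real d"
proof -
  have S': "S \<subseteq> {1..n}" "card S = d" "finite S"
    using S card_supp finite_subset by (auto simp: supp_def)
  have "(\<Sum>S'\<in>supp n \<mu>. chain n \<mu> S S' * f S')
    = (\<Sum>S'\<in>supp n \<mu>. \<Sum>i\<in>S. (if S - {i} \<subseteq> S' then \<mu> S' * f S' else 0) / mass n \<mu> (S - {i}) / real d)"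
    unfolding chain_def sum_distrib_right mass_eq_supp[symmetric]
    using S' by (intro sum.cong refl) (auto simp: field_simps)
  also have "\<dots> = (\<Sum>i\<in>S. \<Sum>S'\<in>supp n \<mu>. (if S - {i} \<subseteq> S' then \<mu> S' * f S' else 0) / mass n \<mu> (S - {i}) / real d)"
    by (rule sum.swap)
  also have "\<dots> = (\<Sum>i\<in>S. down f (S - {i}) / real d)"
  proof (intro sum.cong refl)
    fix i assume i: "i \<in> S"
    then have "Suc (card (S - {i})) = d" using S' by (metis card_Suc_Diff1)
    then have "down f (S - {i}) = (\<Sum>S'\<in>supp n \<mu>. if S - {i} \<subseteq> S' then \<mu> S' * f S' else 0) / mass n \<mu> (S - {i})"
      using S' finite_supp by (subst down_level_pred) (auto simp: sum.inter_filter)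
    then show "(\<Sum>S'\<in>supp n \<mu>. (if S - {i} \<subseteq> S' then \<mu> S' * f S' else 0) / mass n \<mu> (S - {i}) / real d)
      = down f (S - {i}) / real d"
      by (simp add: sum_divide_distrib)
  qed
  finally show ?thesis by (simp add: up_def sum_divide_distrib)
qed

lemma chain_form:
  "(\<Sum>S\<in>supp n \<mu>. \<mu> S * f S * (\<Sum>S'\<in>supp n \<mu>. chain n \<mu> S S' * g S'))
    = level_ip (d - 1) (down f) (down g) / real d"
proof -
  have "(\<Sum>S\<in>supp n \<mu>. \<mu> S * f S * (\<Sum>S'\<in>supp n \<mu>. chain n \<mu> S S' * g S'))
      = level_ip d f (up (down g)) / real d"
    unfolding level_ip_d sum_divide_distrib by (intro sum.cong refl) (simp add: chain_apply)
  then show ?thesis using level_ip_down[of "d - 1" f "down g"] d_pos by simp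
qed

text \<open>By \<open>chain_form\<close> the weighted kernel comes from a symmetric bilinear form;
  its entries are recovered from indicator functions.\<close>

lemma chain_reversible:
  assumes S: "S \<in> supp n \<mu>" "S' \<in> supp n \<mu>"
  shows "\<mu> S * chain n \<mu> S S' = \<mu> S' * chain n \<mu> S' S"
proof -
  have eq: "\<mu> A * chain n \<mu> A B = level_ip (d - 1) (down (\<lambda>T. if T = A then 1 else 0))
      (down (\<lambda>T. if T = B then 1 else 0)) / real d" if "A \<in> supp n \<mu>" "B \<in> supp n \<mu>" for A B
    unfolding chain_form[symmetric] using that finite_supp
    by (simp add: if_distrib[of "\<lambda>a. _ * a"] if_distrib[of "\<lambda>a. a * _"] cong: if_cong)
  show ?thesis
    unfolding eq[OF S] eq[OF S(2,1)] by (simp add: level_ip_def mult_ac)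
qed

section \<open>Eigenvalue bounds and mixing time of the chain\<close>

sublocale reversible_kernel "supp n \<mu>" \<mu> "chain n \<mu>"
  by unfold_locales (auto simp: finite_supp supp_pos chain_reversible)

lemma ip_eq_level_ip: "ip f g = level_ip d f g"
  by (simp add: ip_def level_ip_d)

lemma app_eq_up_down: "S \<in> supp n \<mu> \<Longrightarrow> app f S = up (down f) S / real d"
  by (simp add: app_def chain_apply)

text \<open>The quadratic form is the squared norm of \<open>down f\<close> divided by
  \<open>d\<close>, and \<open>down_contraction\<close> bounds it with the constant
  \<open>(d - 1 - k) / d\<close>.\<close>

lemma ip_app_le:
  assumes "k < d" "\<And>T. T \<in> faces n \<mu> k \<Longrightarrow> (down ^^ (d - k)) f T = 0"
  shows "ip f (app f) \<le> (1 - (real k + 1) / real d) * ip f f"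
proof -
  have d: "Suc (d - 1) = d" using d_pos by simp
  have "(down ^^ (Suc (d - 1) - k)) f T = 0" if T: "T \<in> level k" for T
  proof (cases "T \<in> faces n \<mu> k")
    case True
    then show ?thesis using assms(2) d by simp
  next
    case False
    \<comment> \<open>Off the faces the weight is zero. Since \<open>k < d\<close>, at least one
      \<open>down\<close> is applied, and its division by zero returns 0.\<close>
    then have "weight T = 0" using T mass_eq_0[of T] by (auto simp: level_def weight_def)
    moreover obtain m where "Suc (d - 1) - k = Suc m" using assms(1) d by (metis Suc_diff_Suc)
    ultimately show ?thesis by (simp add: down_def)
  qed
  then have "level_ip (d - 1) (down f) (down f) \<le> (real (d - 1) - real k) * level_ip (Suc (d - 1)) f f"
    using assms(1) by (intro down_contraction) auto
  moreover have "ip f (app f) = level_ip (d - 1) (down f) (down f) / real d"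
    unfolding ip_def app_def by (rule chain_form)
  ultimately show ?thesis
    using d_pos by (simp add: ip_eq_level_ip field_simps of_nat_diff)
qed

lemma eigenvalues_count:
  assumes "k < d"
  shows "size {#e \<in># eigenvalues (supp n \<mu>) (chain n \<mu>). e > 1 - (real k + 1) / real d#}
    \<le> card (faces n \<mu> k)"
proof (rule eigenvalues_above_count[where A = "\<lambda>T f. (down ^^ (d - k)) f T"])
  show "finite (faces n \<mu> k)"
    by (rule finite_subset[of _ "Pow {1..n}"]) (auto simp: faces_def)
qed (use assms in \<open>auto simp: funpow_down_sum intro!: ip_app_le\<close>)

lemma card_faces_le: "card (faces n \<mu> k) \<le> n choose k"
proof -
  have "faces n \<mu> k \<subseteq> {T. T \<subseteq> {1..n} \<and> card T = k}" by (auto simp: faces_def)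
  then have "card (faces n \<mu> k) \<le> card {T. T \<subseteq> {1..n} \<and> card T = k}"
    using finite_level[of k] by (intro card_mono) (simp_all add: level_def)
  then show ?thesis by (simp add: n_subsets)
qed

lemma spectral_gap_ge: "1 / real d \<le> spectral_gap (supp n \<mu>) (chain n \<mu>)"
proof (cases "card (supp n \<mu>) \<le> 1")
  case True
  then show ?thesis using d_pos by (simp add: spectral_gap_def)
next
  case False
  \<comment> \<open>The empty set is the only candidate for a face of size 0, so at most one
    eigenvalue lies above the threshold.\<close>
  have "size {#e \<in># eigenvalues (supp n \<mu>) (chain n \<mu>). e > 1 - (real 0 + 1) / real d#} \<le> 1"
    using eigenvalues_count[of 0] card_faces_le[of 0] d_pos by simp
  then have "rev (sorted_list_of_multiset (eigenvalues (supp n \<mu>) (chain n \<mu>))) ! 1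
      \<le> 1 - (real 0 + 1) / real d"
    using False by (intro second_largest_le) (simp_all add: size_eigenvalues)
  then show ?thesis using False by (simp add: spectral_gap_def)
qed

lemma sum_supp: "sum \<mu> (supp n \<mu>) = 1"
proof -
  have "sum \<mu> (Pow {1..n}) = sum \<mu> (supp n \<mu>)"
    by (rule sum.mono_neutral_right) (auto simp: supp_def)
  then show ?thesis using prob by (simp add: prob_dist_def)
qed

lemma app_const_one:
  assumes S: "S \<in> supp n \<mu>"
  shows "app (\<lambda>_. 1) S = 1"
proof -
  have S': "S \<subseteq> {1..n}" "card S = d" "finite S"
    using S card_supp finite_subset by (auto simp: supp_def)
  have "down (\<lambda>_. 1) (S - {i}) = 1" if "i \<in> S" for i
  proof -
    have "Suc (card (S - {i})) = d" using S' that by (metis card_Suc_Diff1)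
    then show ?thesis
      using S' mass_pos[OF S, of "S - {i}"] by (subst down_level_pred) (auto simp: mass_eq_supp)
  qed
  then show ?thesis using S S' d_pos by (simp add: app_eq_up_down up_def)
qed

text \<open>Both \<open>down\<close> and its adjoint \<open>up\<close> contribute a factor
  \<open>d - 1\<close> to the squared norm, against the normalisation by the square of
  \<open>d\<close>.\<close>

lemma app_contraction:
  assumes "ip f (\<lambda>_. 1) = 0"
  shows "ip (app f) (app f) \<le> (1 - 1 / real d)\<^sup>2 * ip f f"
proof -
  have d: "Suc (d - 1) = d" using d_pos by simp
  have "level_ip 0 ((down ^^ d) f) (\<lambda>_. 1) = 0"
    using level_ip_funpow_down_one[of 0 d f] assms by (simp add: ip_eq_level_ip)
  moreover have level0: "level 0 = {{}}" by (auto simp: level_def finite_subset[OF _ finite_atLeastAtMost])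
  moreover have "weight {} \<noteq> 0"
    using sum_supp by (simp add: weight_def mass_eq_supp)
  ultimately have "(down ^^ d) f {} = 0" by (simp add: level_ip_def)
  then have zero: "(down ^^ (Suc (d - 1) - 0)) f T = 0" if "T \<in> level 0" for T
    using that level0 d by simp
  then have zero': "(down ^^ (d - 1 - 0)) (down f) T = 0" if "T \<in> level 0" for T
    using that by (simp add: funpow_swap1)
  have "ip (app f) (app f) = ip (\<lambda>S. 1 / real d * up (down f) S) (\<lambda>S. 1 / real d * up (down f) S)"
    by (intro ip_cong) (simp_all add: app_eq_up_down)
  also have "\<dots> = (1 / real d)\<^sup>2 * level_ip (Suc (d - 1)) (up (down f)) (up (down f))"
    unfolding ip_scale_left ip_scale_right ip_eq_level_ip d by (simp add: power2_eq_square)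
  also have "\<dots> \<le> (1 / real d)\<^sup>2 * ((real (d - 1) - real 0) * level_ip (d - 1) (down f) (down f))"
    using zero' d_pos by (intro mult_left_mono up_contraction) auto
  also have "\<dots> \<le> (1 / real d)\<^sup>2 * ((real (d - 1) - real 0) * ((real (d - 1) - real 0) * level_ip (Suc (d - 1)) f f))"
    using zero d_pos by (intro mult_left_mono down_contraction) auto
  also have "\<dots> = (1 - 1 / real d)\<^sup>2 * ip f f"
    unfolding d ip_eq_level_ip using d_pos by (simp add: field_simps power2_eq_square of_nat_diff)
  finally show ?thesis .
qed

sublocale contracting_kernel "supp n \<mu>" \<mu> "chain n \<mu>" "1 - 1 / real d"
  using d_pos by unfold_locales (auto simp: sum_supp app_const_one app_contraction)

text \<open>Rounding the time down loses at most one step, which costs the factor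
  \<open>exp (1 / real d)\<close>. The factor 1/2 comes from keeping \<open>1 / \<mu> S - 1\<close>
  under the square root.\<close>

lemma l1_dist_at_floor_le:
  assumes S: "S \<in> supp n \<mu>" and eps: "0 < \<epsilon>" "\<epsilon> < 1"
  defines "x \<equiv> real d * ln (1 / (\<epsilon> * \<mu> S))"
  shows "0 \<le> x"
    and "l1_dist (supp n \<mu>) (kernel_power (supp n \<mu>) (chain n \<mu>) (nat \<lfloor>x\<rfloor>) S)
           (stationary_dist (supp n \<mu>) (chain n \<mu>)) \<le> exp (1 / real d) * \<epsilon> / 2"
proof -
  have pos: "0 < \<mu> S" by (rule supp_pos[OF S])
  have le1: "\<mu> S \<le> 1"
    using member_le_sum[of S "supp n \<mu>" \<mu>] S finite_supp supp_pos sum_supp by (simp add: less_imp_le)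
  have "\<epsilon> * \<mu> S \<le> 1" using eps le1 pos by (intro mult_le_one) auto
  then have "1 \<le> 1 / (\<epsilon> * \<mu> S)" using eps pos by simp
  then show x: "0 \<le> x" by (simp add: x_def)
  define t where "t = nat \<lfloor>x\<rfloor>"
  have t: "x - 1 \<le> real t" using x by (simp add: t_def)
  have c: "0 \<le> 1 - 1 / real d" using d_pos by simp
  have "(1 - 1 / real d) ^ t \<le> exp (- 1 / real d) ^ t"
    using exp_ge_add_one_self[of "- 1 / real d"] c by (intro power_mono) simp_all
  also have "\<dots> = exp (- (real t / real d))" by (simp flip: exp_of_nat_mult)
  also have "\<dots> \<le> exp (1 / real d - x / real d)"
    using t d_pos by (simp add: field_simps)
  also have "\<dots> = exp (1 / real d) * (\<epsilon> * \<mu> S)"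
    using d_pos eps pos by (simp add: x_def ln_div exp_add)
  finally have pow: "(1 - 1 / real d) ^ t \<le> exp (1 / real d) * (\<epsilon> * \<mu> S)" .
  \<comment> \<open>The product is the square root of \<open>\<mu> S * (1 - \<mu> S)\<close>, which
    is largest at \<open>\<mu> S = 1 / 2\<close>.\<close>
  have "\<mu> S * sqrt (1 / \<mu> S - 1) = sqrt ((\<mu> S)\<^sup>2 * (1 / \<mu> S - 1))"
    using pos by (simp add: real_sqrt_mult)
  also have "\<dots> \<le> sqrt ((1 / 2)\<^sup>2)"
  proof (rule real_sqrt_le_mono)
    have "(\<mu> S)\<^sup>2 * (1 / \<mu> S - 1) = (1 / 2)\<^sup>2 - (\<mu> S - 1 / 2)\<^sup>2"
      using pos by (simp add: field_simps power2_eq_square)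
    then show "(\<mu> S)\<^sup>2 * (1 / \<mu> S - 1) \<le> (1 / 2)\<^sup>2" by simp
  qed
  finally have half: "\<mu> S * sqrt (1 / \<mu> S - 1) \<le> 1 / 2" by simp
  have "l1_dist (supp n \<mu>) (kernel_power (supp n \<mu>) (chain n \<mu>) t S)
           (stationary_dist (supp n \<mu>) (chain n \<mu>)) \<le> (1 - 1 / real d) ^ t * sqrt (1 / \<mu> S - 1)"
    by (rule l1_dist_kernel_power_le[OF S])
  also have "\<dots> \<le> (exp (1 / real d) * (\<epsilon> * \<mu> S)) * sqrt (1 / \<mu> S - 1)"
    using pos le1 by (intro mult_right_mono pow) simp
  also have "\<dots> = exp (1 / real d) * \<epsilon> * (\<mu> S * sqrt (1 / \<mu> S - 1))" by simp
  also have "\<dots> \<le> exp (1 / real d) * \<epsilon> * (1 / 2)"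
    using eps by (intro mult_left_mono half) simp
  finally show "l1_dist (supp n \<mu>) (kernel_power (supp n \<mu>) (chain n \<mu>) (nat \<lfloor>x\<rfloor>) S)
           (stationary_dist (supp n \<mu>) (chain n \<mu>)) \<le> exp (1 / real d) * \<epsilon> / 2"
    by (simp add: t_def)
qed

text \<open>Total variation brings a second factor 1/2, and \<open>exp 1 \<le> 3\<close> then
  suffices. For the L1 distance \<open>exp (1 / real d) \<le> 2\<close> is required, which holds
  from \<open>d = 2\<close> on. At \<open>d = 1\<close> the L1 bound can fail: for the uniform
  distribution on two singletons and \<open>\<epsilon> = 0.9\<close> it is below 1, but the distance
  at time 0 is 1.\<close>

lemma mixing_time_le:
  assumes S: "S \<in> supp n \<mu>" and eps: "0 < \<epsilon>" "\<epsilon> < 1"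
  shows "ereal_of_enat (mixing_time tv_dist (supp n \<mu>) (chain n \<mu>) S \<epsilon>)
      \<le> ereal (real d * ln (1 / (\<epsilon> * \<mu> S)))" (is ?tv)
    and "d \<noteq> 1 \<Longrightarrow> ereal_of_enat (mixing_time l1_dist (supp n \<mu>) (chain n \<mu>) S \<epsilon>)
      \<le> ereal (real d * ln (1 / (\<epsilon> * \<mu> S)))"
proof -
  define x where "x = real d * ln (1 / (\<epsilon> * \<mu> S))"
  note l1 = l1_dist_at_floor_le[OF S eps, folded x_def]
  have mix: "ereal_of_enat (mixing_time D (supp n \<mu>) (chain n \<mu>) S \<epsilon>) \<le> ereal x"
    if "D (supp n \<mu>) (kernel_power (supp n \<mu>) (chain n \<mu>) (nat \<lfloor>x\<rfloor>) S)
           (stationary_dist (supp n \<mu>) (chain n \<mu>)) \<le> \<epsilon>" for D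
  proof -
    have "mixing_time D (supp n \<mu>) (chain n \<mu>) S \<epsilon> \<le> enat (nat \<lfloor>x\<rfloor>)"
      unfolding mixing_time_def using that by (intro Inf_lower) auto
    then have "ereal_of_enat (mixing_time D (supp n \<mu>) (chain n \<mu>) S \<epsilon>) \<le> ereal_of_enat (enat (nat \<lfloor>x\<rfloor>))"
      by (simp only: ereal_of_enat_le_iff)
    also have "\<dots> \<le> ereal x" using l1(1) by simp
    finally show ?thesis .
  qed
  have "exp (1 / real d) \<le> exp 1" using d_pos by simp
  also have "exp 1 \<le> (3 :: real)" by (rule exp_le)
  finally have "exp (1 / real d) * \<epsilon> \<le> 3 * \<epsilon>" using eps by (intro mult_right_mono) auto
  then show ?tv
    unfolding x_def[symmetric] using l1(2) eps by (intro mix) (unfold tv_dist_def, linarith)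
  assume "d \<noteq> 1"
  then have "1 / real d \<le> 1 / 2" using d_pos by (simp add: field_simps)
  then have "exp (1 / real d) \<le> exp (1 / 2)" by simp
  moreover have "exp (1 / 2) \<le> (2 :: real)"
  proof (rule power2_le_imp_le)
    show "(exp (1 / 2 :: real))\<^sup>2 \<le> 2\<^sup>2" using exp_le by (simp flip: exp_double)
  qed simp
  ultimately have "exp (1 / real d) \<le> 2" by (rule order_trans)
  then have "exp (1 / real d) * \<epsilon> \<le> 2 * \<epsilon>" using eps by (intro mult_right_mono) auto
  then show "ereal_of_enat (mixing_time l1_dist (supp n \<mu>) (chain n \<mu>) S \<epsilon>)
      \<le> ereal (real d * ln (1 / (\<epsilon> * \<mu> S)))"
    unfolding x_def[symmetric] using l1(2) by (intro mix) linarith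
qed

end

theorem theorem1p1:
  fixes n d :: nat and \<mu> :: "nat set \<Rightarrow> real"
  assumes "1 \<le> d"
    and "prob_dist n \<mu>"
    and "homogeneous n d \<mu>"
    and "strongly_log_concave_at_one n (gen_poly n \<mu>)"
  shows "(\<forall>k<d. size {# e \<in># eigenvalues (supp n \<mu>) (chain n \<mu>). e > 1 - (real k + 1) / real d #}
                  \<le> card (faces n \<mu> k)
              \<and> card (faces n \<mu> k) \<le> n choose k)
       \<and> spectral_gap (supp n \<mu>) (chain n \<mu>) \<ge> 1 / real d
       \<and> (\<forall>\<tau>\<in>supp n \<mu>. \<forall>\<epsilon>. 0 < \<epsilon> \<and> \<epsilon> < 1 \<longrightarrow>
            ereal_of_enat (mixing_time tv_dist (supp n \<mu>) (chain n \<mu>) \<tau> \<epsilon>)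
              \<le> ereal (real d * ln (1 / (\<epsilon> * \<mu> \<tau>)))
          \<and> (d \<noteq> 1 \<longrightarrow>
              ereal_of_enat (mixing_time l1_dist (supp n \<mu>) (chain n \<mu>) \<tau> \<epsilon>)
                \<le> ereal (real d * ln (1 / (\<epsilon> * \<mu> \<tau>)))))"
proof -
  interpret slc_distribution n d \<mu> using assms by unfold_locales
  show ?thesis
    using eigenvalues_count card_faces_le spectral_gap_ge mixing_time_le by blast
qed

end
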